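(* Let $k\ge 2$ and let $F,F'$ be minimally unsatisfiable 2-CNFs of deficiency $k$. Then the set of isomorphisms $f:F\to F'$ (as maps from the literals of $F$ to the literals of $F'$) equals the set of digraph isomorphisms $f:\mathrm{idg}(F)\to\mathrm{idg}(F')$ (as maps between vertex sets).
   Context: Literals are variables and their complements; a clause is a finite set of literals without complementary pair; a 2-CNF is a finite set of clauses of size at most 2. Deficiency $\delta(F)=|F|-n(F)$, $n(F)$ the number of variables. Minimally unsatisfiable: unsatisfiable, and removing any clause makes it satisfiable. An isomorphism $F\to F'$ is a bijection $f$ from the literals of $F$ to those of $F'$ with $f(\overline x)=\overline{f(x)}$ and $\{f(C):C\in F\}=F'$. For a 2-CNF $F$ without empty clause, $\mathrm{idg}(F)$ has vertex set the literals over variables of $F$, arcs $(\overline x,x)$ for unit-clauses $\{x\}$, and arcs $(\overline x,y),(\overline y,x)$ for clauses $\{x,y\}$, $x\neq y$. A digraph isomorphism is a bijection of vertex sets mapping the arc set exactly onto the arc set. *)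

theory Defs
  imports "Graph_Theory.Pair_Digraph" "HOL-Library.FuncSet"
begin

datatype 'v literal = Pos 'v | Neg 'v

fun var_of :: "'v literal \<Rightarrow> 'v" where
  "var_of (Pos v) = v"
| "var_of (Neg v) = v"

fun complement :: "'v literal \<Rightarrow> 'v literal" where
  "complement (Pos v) = Neg v"
| "complement (Neg v) = Pos v"

type_synonym 'v clause_set = "'v literal set set"

definition is_clause :: "'v literal set \<Rightarrow> bool" where
  "is_clause C \<longleftrightarrow> finite C \<and> (\<forall>x\<in>C. complement x \<notin> C)"

definition two_cnf :: "'v clause_set \<Rightarrow> bool" where
  "two_cnf F \<longleftrightarrow> finite F \<and> (\<forall>C\<in>F. is_clause C \<and> card C \<le> 2)"

definition vars :: "'v clause_set \<Rightarrow> 'v set" where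
  "vars F = var_of ` \<Union>F"

text \<open>Both literals over every variable of \<open>F\<close>, not only those occurring in some clause.\<close>
definition lits :: "'v clause_set \<Rightarrow> 'v literal set" where
  "lits F = {x. var_of x \<in> vars F}"

definition deficiency :: "'v clause_set \<Rightarrow> int" where
  "deficiency F = int (card F) - int (card (vars F))"

fun lit_true :: "('v \<Rightarrow> bool) \<Rightarrow> 'v literal \<Rightarrow> bool" where
  "lit_true \<phi> (Pos v) = \<phi> v"
| "lit_true \<phi> (Neg v) = (\<not> \<phi> v)"

definition satisfiable :: "'v clause_set \<Rightarrow> bool" where
  "satisfiable F \<longleftrightarrow> (\<exists>\<phi>. \<forall>C\<in>F. \<exists>x\<in>C. lit_true \<phi> x)"

definition minimally_unsatisfiable :: "'v clause_set \<Rightarrow> bool" where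
  "minimally_unsatisfiable F \<longleftrightarrow>
     \<not> satisfiable F \<and> (\<forall>C\<in>F. satisfiable (F - {C}))"

text \<open>A map with domain \<open>A\<close> is represented by a function in \<open>extensional A\<close>, so that
  equality of such functions is equality of maps on \<open>A\<close>.\<close>

definition cnf_isos :: "'v clause_set \<Rightarrow> 'w clause_set \<Rightarrow> ('v literal \<Rightarrow> 'w literal) set" where
  "cnf_isos F F' = {f \<in> extensional (lits F).
     bij_betw f (lits F) (lits F') \<and>
     (\<forall>x\<in>lits F. f (complement x) = complement (f x)) \<and>
     {f ` C | C. C \<in> F} = F'}"

text \<open>Meant for 2-CNFs without the empty clause.  By symmetry in \<open>x\<close> and \<open>y\<close>, a clause
  \<open>{x, y}\<close> contributes both of its arcs to the second set.\<close>
definition idg :: "'v clause_set \<Rightarrow> 'v literal pair_pre_digraph" where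
  "idg F = \<lparr> pverts = lits F,
     parcs = {(complement x, x) | x. {x} \<in> F}
           \<union> {(complement x, y) | x y. x \<noteq> y \<and> {x, y} \<in> F} \<rparr>"

definition digraph_isos :: "'a pair_pre_digraph \<Rightarrow> 'b pair_pre_digraph \<Rightarrow> ('a \<Rightarrow> 'b) set" where
  "digraph_isos G H = {f \<in> extensional (pverts G).
     bij_betw f (pverts G) (pverts H) \<and>
     {(f u, f v) | u v. (u, v) \<in> parcs G} = parcs H}"

end

theory Submission
  imports Defs
begin

text \<open>
  A digraph isomorphism pulls the complementation of \<open>F'\<close> back to a second skew-symmetry \<open>\<tau>\<close> of \<open>idg F\<close>,
  besides complementation \<open>\<sigma>\<close>, with respect to which \<open>idg F\<close> is again minimally contradictory; the
  point is that \<open>\<tau> = \<sigma>\<close>.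

  Deficiency at least 2 excludes unit clauses, so no arc joins a vertex to its mate. There is a
  simple cycle \<open>b\<close> of some length \<open>L\<close> through a vertex and its mate, and by minimality \<open>b\<close> and \<open>\<sigma> b\<close>
  together contain all arcs. Whether a simple cycle contains a vertex and its mate depends only on its
  length, so \<open>b\<close> and \<open>\<tau> b\<close> contain all arcs as well. This forces \<open>\<sigma> b\<close> and \<open>\<tau> b\<close> to be the same reversed
  cycle, whence \<open>\<tau> (b i) = \<sigma> (b (i + c))\<close> for a constant \<open>c\<close>.

  Call \<open>(i, a)\<close> a chord if \<open>b a = \<sigma> (b i)\<close>. By minimality, two chords that do not cross bound an
  interval that \<open>\<sigma>\<close> reverses. Chords are stable under \<open>(i, a) \<mapsto> (i + c, a - c)\<close>; unless \<open>L\<close> divides \<open>2 * c\<close>,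
  some chord does not cross its translate, and the reversed interval then extends around the cycle. If
  \<open>L\<close> divides \<open>2 * c\<close> but not \<open>c\<close>, the same argument gives an interval reversed by \<open>\<tau>\<close>. But in the
  middle of a reversed interval there is a fixed point or an arc joining a vertex to its mate.
\<close>

section \<open>Closed walks\<close>

definition walk_arcs :: "(int \<Rightarrow> 'a) \<Rightarrow> ('a \<times> 'a) set" where
  "walk_arcs f = range (\<lambda>i. (f i, f (i + 1)))"

definition closed_walk :: "('a \<times> 'a) set \<Rightarrow> int \<Rightarrow> (int \<Rightarrow> 'a) \<Rightarrow> bool" where
  "closed_walk E L f \<longleftrightarrow> 0 < L \<and> walk_arcs f \<subseteq> E \<and> (\<forall>i j. L dvd j - i \<longrightarrow> f i = f j)"

definition simple_cycle :: "('a \<times> 'a) set \<Rightarrow> int \<Rightarrow> (int \<Rightarrow> 'a) \<Rightarrow> bool" where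
  "simple_cycle E L b \<longleftrightarrow> closed_walk E L b \<and> (\<forall>i j. b i = b j \<longrightarrow> L dvd j - i)"

lemma arc_in_walk_arcs [simp]: "(f i, f (i + 1)) \<in> walk_arcs f"
  by (simp add: walk_arcs_def)

lemma closed_walk_length_pos: "closed_walk E L f \<Longrightarrow> 0 < L"
  by (simp add: closed_walk_def)

lemma closed_walk_arc: "closed_walk E L f \<Longrightarrow> (f i, f (i + 1)) \<in> E"
  using arc_in_walk_arcs[of f i] unfolding closed_walk_def by blast

lemma closed_walk_eq: "closed_walk E L f \<Longrightarrow> L dvd j - i \<Longrightarrow> f i = f j"
  by (simp add: closed_walk_def)

lemma simple_cycle_closed_walk: "simple_cycle E L b \<Longrightarrow> closed_walk E L b"
  by (simp add: simple_cycle_def)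

lemma simple_cycle_eq_iff: "simple_cycle E L b \<Longrightarrow> b i = b j \<longleftrightarrow> L dvd j - i"
  unfolding simple_cycle_def closed_walk_def by blast

lemma ex_representative_in_window:
  fixes i k L :: int
  assumes "0 < L"
  obtains k' where "L dvd k' - k" "i \<le> k'" "k' < i + L"
proof
  have "L dvd (k - i) - (k - i) mod L"
    by simp
  then have "L dvd - ((k - i) - (k - i) mod L)"
    by (simp only: dvd_minus_iff)
  then show "L dvd (i + (k - i) mod L) - k"
    by (simp add: algebra_simps)
qed (use assms in simp_all)

lemma rtrancl_segment:
  fixes f :: "int \<Rightarrow> 'a"
  assumes "i \<le> j" "\<And>k. i \<le> k \<Longrightarrow> k < j \<Longrightarrow> (f k, f (k + 1)) \<in> R"
  shows "(f i, f j) \<in> R\<^sup>*"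
  using assms by (induction rule: int_ge_induct) (auto intro: rtrancl_into_rtrancl)

lemma closed_walk_rtrancl:
  assumes "closed_walk R L f"
  shows "(f i, f j) \<in> R\<^sup>*"
proof -
  obtain k where "L dvd k - j" "i \<le> k"
    using ex_representative_in_window[OF closed_walk_length_pos[OF assms]] by blast
  then show ?thesis
    using rtrancl_segment[of i k f R] closed_walk_arc[OF assms] closed_walk_eq[OF assms] by metis
qed

lemma extend_segment_rtrancl:
  fixes f :: "int \<Rightarrow> 'a"
  assumes "(f j, z) \<in> R\<^sup>*"
  obtains k g where "j \<le> k" "g k = z" "\<forall>i\<le>j. g i = f i"
    "\<forall>i\<in>{j..<k}. (g i, g (i + 1)) \<in> R"
  using assms
proof (induction arbitrary: thesis rule: rtrancl_induct)
  case base
  show ?case by (rule base[of j f]) simp_all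
next
  case (step y z)
  from step.IH obtain k g where "j \<le> k" "g k = y" "\<forall>i\<le>j. g i = f i"
    "\<forall>i\<in>{j..<k}. (g i, g (i + 1)) \<in> R"
    by blast
  with step.hyps(2) show ?case
    by (intro step.prems[of "k + 1" "g(k + 1 := z)"]) auto
qed

lemma closed_walk_of_window:
  fixes h :: "int \<Rightarrow> 'a"
  assumes "i < j" "h j = h i" "\<And>k. i \<le> k \<Longrightarrow> k < j \<Longrightarrow> (h k, h (k + 1)) \<in> E"
  obtains f where "closed_walk E (j - i) f" "\<forall>k\<in>{i..j}. f k = h k"
proof
  define L where "L = j - i"
  have "0 < L"
    using assms(1) by (simp add: L_def)
  define f where "f = (\<lambda>k. h (i + (k - i) mod L))"
  show "\<forall>k\<in>{i..j}. f k = h k"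
  proof
    fix k assume "k \<in> {i..j}"
    then show "f k = h k"
      using assms(2) by (cases "k = j") (auto simp: f_def L_def)
  qed
  have "(f k, f (k + 1)) \<in> E" for k
  proof -
    define m where "m = (k - i) mod L"
    have m: "0 \<le> m" "m < L"
      using \<open>0 < L\<close> by (simp_all add: m_def)
    have "(m + 1) mod L = (k - i + 1) mod L"
      by (simp only: m_def mod_add_left_eq)
    then have "(k + 1 - i) mod L = (m + 1) mod L"
      by (simp add: diff_add_eq)
    also have "\<dots> = (if m + 1 = L then 0 else m + 1)"
      using m by auto
    finally have "f (k + 1) = h (i + m + 1)"
      using assms(2) by (auto simp: f_def L_def algebra_simps)
    then show ?thesis
      using assms(3)[of "i + m"] m by (simp add: f_def m_def L_def)
  qed
  moreover have "f k = f l" if "L dvd l - k" for k l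
  proof -
    have "(l - i) mod L = (k - i) mod L"
      using that by (simp add: mod_eq_dvd_iff)
    then show ?thesis by (simp add: f_def)
  qed
  ultimately show "closed_walk E (j - i) f"
    using \<open>0 < L\<close> unfolding closed_walk_def walk_arcs_def L_def by blast
qed

lemma closed_walk_of_rtrancl:
  fixes x y :: 'a
  assumes "(x, y) \<in> E\<^sup>*" "(y, x) \<in> E\<^sup>*" "x \<noteq> y"
  obtains L f p q where "closed_walk E L f" "f p = x" "f q = y"
proof -
  obtain p and g :: "int \<Rightarrow> 'a" where g: "0 \<le> p" "g p = y" "\<forall>i\<le>0. g i = x"
    "\<forall>i\<in>{0..<p}. (g i, g (i + 1)) \<in> E"
    using assms(1) by (rule extend_segment_rtrancl[of "\<lambda>_. x" 0])
  from assms(2) have "(g p, x) \<in> E\<^sup>*"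
    unfolding g(2) .
  then obtain q h where h: "p \<le> q" "h q = x" "\<forall>i\<le>p. h i = g i"
    "\<forall>i\<in>{p..<q}. (h i, h (i + 1)) \<in> E"
    by (rule extend_segment_rtrancl)
  have ends: "h 0 = x" "h p = y"
    using g(1-3) h(3) by simp_all
  then have "p \<noteq> 0"
    using assms(3) by auto
  then have "0 < q" "h q = h 0"
    using g(1) h(1,2) ends by simp_all
  moreover have "(h i, h (i + 1)) \<in> E" if "0 \<le> i" "i < q" for i
    using that g(4) h(3,4) by (cases "i < p") auto
  ultimately obtain f where "closed_walk E (q - 0) f" "\<forall>k\<in>{0..q}. f k = h k"
    by (rule closed_walk_of_window)
  then show thesis
    using that[of "q - 0" f 0 p] g(1) h(1) ends by simp
qed

lemma repetition_of_nonsimple: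
  assumes "closed_walk E L f" "\<not> simple_cycle E L f"
  obtains i j where "i < j" "j < i + L" "f i = f j"
proof -
  obtain i k where ik: "f i = f k" "\<not> L dvd k - i"
    using assms by (auto simp: simple_cycle_def)
  obtain j where j: "L dvd j - k" "i \<le> j" "j < i + L"
    by (rule ex_representative_in_window[OF closed_walk_length_pos[OF assms(1)]])
  have "f i = f j"
    using ik(1) closed_walk_eq[OF assms(1) j(1)] by simp
  moreover have "i \<noteq> j"
    using ik(2) j(1) by (auto simp: dvd_diff_commute)
  ultimately show thesis
    using that[of i j] j by simp
qed

lemma closed_walks_eq_up_to_rotation:
  assumes "closed_walk E L c" "closed_walk E L d" "c s = d r"
    and step: "\<And>i j. c i = d j \<Longrightarrow> c (i + 1) = d (j + 1)"
  shows "c i = d (i + (r - s))"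
proof -
  obtain k where k: "L dvd k - i" "s \<le> k"
    using ex_representative_in_window[OF closed_walk_length_pos[OF assms(1)]] by blast
  from \<open>s \<le> k\<close> have "c k = d (k + (r - s))"
  proof (induction k rule: int_ge_induct)
    case base
    then show ?case using assms(3) by simp
  next
    case (step k)
    then show ?case using assms(4)[OF step.IH] by (simp add: algebra_simps)
  qed
  moreover have "c i = c k" "d (i + (r - s)) = d (k + (r - s))"
    using k(1) by (auto intro!: closed_walk_eq[OF assms(1)] closed_walk_eq[OF assms(2)])
  ultimately show ?thesis by simp
qed

lemma simple_cycle_successor:
  assumes "simple_cycle E L b" "(x, y) \<in> walk_arcs b" "x = b k"
  shows "y = b (k + 1)"
  using assms simple_cycle_eq_iff[OF assms(1)] by (auto simp: walk_arcs_def dvd_diff_commute)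

lemma rotation_of_walk_arcs_subset:
  assumes "simple_cycle E L b" "closed_walk E L c" "walk_arcs c \<subseteq> walk_arcs b"
  obtains k where "\<forall>i. c i = b (i + k)"
proof -
  have follow: "c (i + 1) = b (j + 1)" if "c i = b j" for i j
    using simple_cycle_successor[OF assms(1) subsetD[OF assms(3) arc_in_walk_arcs] that] .
  have "(c 0, c (0 + 1)) \<in> walk_arcs b"
    using assms(3) arc_in_walk_arcs by blast
  then obtain r where "c 0 = b r"
    by (auto simp: walk_arcs_def)
  from closed_walks_eq_up_to_rotation[OF assms(2) simple_cycle_closed_walk[OF assms(1)] this follow]
  show thesis
    using that by blast
qed

lemma rotation_of_walk_arcs_Un_eq:
  assumes b: "simple_cycle E L b" and c: "simple_cycle E L c" and d: "simple_cycle E L d"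
    and arcs: "walk_arcs b \<union> walk_arcs c = walk_arcs b \<union> walk_arcs d"
    and not_subset: "\<not> walk_arcs c \<subseteq> walk_arcs b"
  obtains k where "\<forall>i. d i = c (i + k)"
proof -
  have follow: "d (i + 1) = c (j + 1)" if eq: "d i = c j" for i j
  proof -
    consider "(d i, d (i + 1)) \<in> walk_arcs c" | "(c j, c (j + 1)) \<in> walk_arcs d"
      | "(d i, d (i + 1)) \<in> walk_arcs b" "(c j, c (j + 1)) \<in> walk_arcs b"
      using arcs arc_in_walk_arcs[of c j] arc_in_walk_arcs[of d i] by blast
    then show ?thesis
    proof cases
      case 1
      then show ?thesis using simple_cycle_successor[OF c] eq by blast
    next
      case 2
      then show ?thesis using simple_cycle_successor[OF d] eq by metis
    next
      case 3
      then obtain k where "d i = b k"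
        by (auto simp: walk_arcs_def)
      with 3 show ?thesis using simple_cycle_successor[OF b] eq by metis
    qed
  qed
  obtain s where "(c s, c (s + 1)) \<notin> walk_arcs b"
    using not_subset by (auto simp: walk_arcs_def)
  then have "(c s, c (s + 1)) \<in> walk_arcs d"
    using arcs arc_in_walk_arcs[of c s] by blast
  then obtain r where "d r = c s"
    by (auto simp: walk_arcs_def)
  from closed_walks_eq_up_to_rotation[OF d[THEN simple_cycle_closed_walk]
      c[THEN simple_cycle_closed_walk] this follow]
  show thesis
    using that by blast
qed

lemma card_range_simple_cycle:
  assumes "simple_cycle E L b"
  shows "finite (range b)" "int (card (range b)) = L"
proof -
  have "0 < L"
    using closed_walk_length_pos[OF simple_cycle_closed_walk[OF assms]] .
  have eq: "b i = b j \<longleftrightarrow> i mod L = j mod L" for i j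
    using simple_cycle_eq_iff[OF assms, of j i] by (auto simp: mod_eq_dvd_iff)
  have "b i \<in> b ` {0..<L}" for i
    using \<open>0 < L\<close> eq[of i "i mod L"] by (intro image_eqI[of _ b "i mod L"]) simp_all
  then have "range b = b ` {0..<L}"
    by blast
  moreover have "inj_on b {0..<L}"
    by (auto intro!: inj_onI simp: eq)
  ultimately show "finite (range b)" "int (card (range b)) = L"
    using \<open>0 < L\<close> by (simp_all add: card_image)
qed


section \<open>Skew-symmetric digraphs\<close>

definition contradictory :: "'a set \<Rightarrow> ('a \<Rightarrow> 'a) \<Rightarrow> ('a \<times> 'a) set \<Rightarrow> bool" where
  "contradictory V \<sigma> R \<longleftrightarrow> (\<exists>v\<in>V. (v, \<sigma> v) \<in> R\<^sup>* \<and> (\<sigma> v, v) \<in> R\<^sup>*)"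

locale skew_digraph =
  fixes V :: "'a set" and E :: "('a \<times> 'a) set" and \<sigma> :: "'a \<Rightarrow> 'a"
  assumes arcs_subset: "E \<subseteq> V \<times> V"
    and mate_in_V [simp]: "v \<in> V \<Longrightarrow> \<sigma> v \<in> V"
    and mate_mate [simp]: "v \<in> V \<Longrightarrow> \<sigma> (\<sigma> v) = v"
    and mate_neq: "v \<in> V \<Longrightarrow> \<sigma> v \<noteq> v"
    and skew: "(u, w) \<in> E \<Longrightarrow> (\<sigma> w, \<sigma> u) \<in> E"
begin

lemma arc_in_V: "(u, w) \<in> E \<Longrightarrow> u \<in> V" "(u, w) \<in> E \<Longrightarrow> w \<in> V"
  using arcs_subset by auto

lemma rtrancl_in_V: "(u, w) \<in> E\<^sup>* \<Longrightarrow> u \<in> V \<Longrightarrow> w \<in> V"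
  by (induction rule: rtrancl_induct) (auto dest: arc_in_V)

lemma rtrancl_skew: "(u, w) \<in> E\<^sup>* \<Longrightarrow> (\<sigma> w, \<sigma> u) \<in> E\<^sup>*"
  by (induction rule: rtrancl_induct) (auto intro: skew converse_rtrancl_into_rtrancl)

lemma skew_digraph_remove_arc:
  assumes "(u, w) \<in> E"
  shows "skew_digraph V (E - {(u, w), (\<sigma> w, \<sigma> u)}) \<sigma>"
proof
  fix x y assume xy: "(x, y) \<in> E - {(u, w), (\<sigma> w, \<sigma> u)}"
  then have "x \<in> V" "y \<in> V"
    using arc_in_V by auto
  then have flip: "(\<sigma> y, \<sigma> x) = (a, b) \<longleftrightarrow> (x, y) = (\<sigma> b, \<sigma> a)" if "a \<in> V" "b \<in> V" for a b
    using that by auto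
  show "(\<sigma> y, \<sigma> x) \<in> E - {(u, w), (\<sigma> w, \<sigma> u)}"
    using flip[of u w] flip[of "\<sigma> w" "\<sigma> u"] xy skew[of x y] arc_in_V[OF assms] by simp
qed (use arcs_subset mate_neq in auto)


subsection \<open>Consistent sets\<close>

definition consistent_closed :: "'a set \<Rightarrow> bool" where
  "consistent_closed T \<longleftrightarrow> T \<subseteq> V \<and> (\<forall>v\<in>T. \<sigma> v \<notin> T) \<and> E `` T \<subseteq> T"

lemma consistent_closed_extend:
  assumes T: "consistent_closed T" and u: "u \<in> V" "\<sigma> u \<notin> T" "(u, \<sigma> u) \<notin> E\<^sup>*"
  shows "consistent_closed (T \<union> E\<^sup>* `` {u})"
proof -
  have reach_V: "x \<in> V" if "(u, x) \<in> E\<^sup>*" for x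
    using rtrancl_in_V that u(1) by blast
  have T_closed: "y \<in> T" if "(x, y) \<in> E\<^sup>*" "x \<in> T" for x y
    using that T by (induction rule: rtrancl_induct) (auto simp: consistent_closed_def)
  have mate_reach: "(\<sigma> x, \<sigma> u) \<in> E\<^sup>*" if "(u, x) \<in> E\<^sup>*" for x
    using rtrancl_skew[OF that] .
  have "\<sigma> x \<notin> T \<union> E\<^sup>* `` {u}" if "x \<in> T \<union> E\<^sup>* `` {u}" for x
  proof (cases "x \<in> T")
    case True
    then have "x \<in> V" "\<sigma> x \<notin> T"
      using T by (auto simp: consistent_closed_def)
    moreover have "(u, \<sigma> x) \<notin> E\<^sup>*"
      using mate_reach[of "\<sigma> x"] T_closed[of x "\<sigma> u"] True u \<open>x \<in> V\<close> by auto
    ultimately show ?thesis by blast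
  next
    case False
    then have x: "(u, x) \<in> E\<^sup>*"
      using that by blast
    then have "\<sigma> x \<notin> T"
      using T_closed[OF mate_reach[OF x]] u(2) by blast
    moreover have "(u, \<sigma> x) \<notin> E\<^sup>*"
      using mate_reach[OF x] u(3) by (metis rtrancl_trans)
    ultimately show ?thesis by blast
  qed
  moreover have "E `` (T \<union> E\<^sup>* `` {u}) \<subseteq> T \<union> E\<^sup>* `` {u}"
    using T by (auto simp: consistent_closed_def intro: rtrancl_into_rtrancl)
  ultimately show ?thesis
    using T reach_V by (auto simp: consistent_closed_def)
qed

lemma ex_total_consistent_closed:
  assumes "finite V" "\<not> contradictory V \<sigma> E"
  obtains T where "consistent_closed T" "\<And>v. v \<in> V \<Longrightarrow> v \<in> T \<or> \<sigma> v \<in> T"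
proof -
  have "{T. consistent_closed T} \<subseteq> Pow V" "consistent_closed {}"
    by (auto simp: consistent_closed_def)
  then have "finite {T. consistent_closed T}" "{T. consistent_closed T} \<noteq> {}"
    using assms(1) finite_subset by auto
  from finite_has_maximal[OF this] obtain T where T: "consistent_closed T"
    and maximal: "\<And>T'. consistent_closed T' \<Longrightarrow> T \<subseteq> T' \<Longrightarrow> T = T'"
    by blast
  have decided: "v \<in> T \<or> \<sigma> v \<in> T" if "v \<in> V" "(v, \<sigma> v) \<notin> E\<^sup>*" for v
    using maximal[OF consistent_closed_extend[OF T that(1) _ that(2)]] by blast
  have "v \<in> T \<or> \<sigma> v \<in> T" if "v \<in> V" for v
    using decided[of v] decided[of "\<sigma> v"] assms(2) that unfolding contradictory_def by auto
  with T show thesis by (rule that)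
qed


subsection \<open>Shortest contradictory closed walks\<close>

definition chord :: "(int \<Rightarrow> 'a) \<Rightarrow> int \<Rightarrow> int \<Rightarrow> bool" where
  "chord f p q \<longleftrightarrow> f q = \<sigma> (f p)"

definition shortest_contradictory_walk :: "int \<Rightarrow> (int \<Rightarrow> 'a) \<Rightarrow> bool" where
  "shortest_contradictory_walk L f \<longleftrightarrow> closed_walk E L f \<and> (\<exists>p q. chord f p q) \<and>
     (\<forall>M g p q. closed_walk E M g \<longrightarrow> chord g p q \<longrightarrow> L \<le> M)"

definition crossing :: "int \<Rightarrow> (int \<Rightarrow> 'a) \<Rightarrow> int \<Rightarrow> int \<Rightarrow> int \<Rightarrow> int \<Rightarrow> bool" where
  "crossing L f p r q s \<longleftrightarrow>
     p < r \<and> r < q \<and> q < s \<and> s < p + L \<and> chord f p q \<and> chord f r s"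

lemma closed_walk_in_V: "closed_walk E L f \<Longrightarrow> f i \<in> V"
  using closed_walk_arc arc_in_V(1) by metis

lemma chord_sym: "closed_walk E L f \<Longrightarrow> chord f p q \<longleftrightarrow> chord f q p"
  using closed_walk_in_V mate_mate unfolding chord_def by metis

lemma chord_cong:
  assumes "closed_walk E L f" "L dvd p' - p" "L dvd q' - q"
  shows "chord f p q \<longleftrightarrow> chord f p' q'"
  using closed_walk_eq[OF assms(1,2)] closed_walk_eq[OF assms(1,3)] by (simp add: chord_def)

lemma chord_irrefl: "closed_walk E L f \<Longrightarrow> \<not> chord f p p"
  using mate_neq closed_walk_in_V unfolding chord_def by metis

lemma chord_in_window:
  assumes "closed_walk E L f" "chord f p q"
  obtains p' q' where "i \<le> p'" "p' < q'" "q' < i + L" "chord f p' q'"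
proof -
  note window = ex_representative_in_window[OF closed_walk_length_pos[OF assms(1)], where i = i]
  obtain p' where p': "L dvd p' - p" "i \<le> p'" "p' < i + L"
    by (rule window)
  obtain q' where q': "L dvd q' - q" "i \<le> q'" "q' < i + L"
    by (rule window)
  have chord: "chord f p' q'"
    using chord_cong[OF assms(1) p'(1) q'(1)] assms(2) by simp
  then have "p' \<noteq> q'"
    using chord_irrefl[OF assms(1)] by blast
  with chord show thesis
    using that p' q' chord_sym[OF assms(1)] by (metis linorder_neqE)
qed

lemma crossing_rotate:
  assumes "closed_walk E L f" "crossing L f p r q s"
  shows "crossing L f r q s (p + L)"
  using assms chord_sym[OF assms(1), of p q] chord_cong[OF assms(1), of q q "p + L" p]
  by (simp add: crossing_def)

lemma crossing_in_window:
  assumes walk: "closed_walk E L f" and "crossing L f p r q s"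
  obtains p' r' q' s' where "i \<le> p'" "s' < i + L" "crossing L f p' r' q' s'"
proof -
  obtain s' where s': "L dvd s' - s" "i \<le> s'" "s' < i + L"
    by (rule ex_representative_in_window[OF closed_walk_length_pos[OF walk]])
  define d where "d = s' - s"
  have "s + d = s'" "L dvd d"
    using s'(1) by (simp_all add: d_def)
  then have "chord f (x + d) (y + d) \<longleftrightarrow> chord f x y" for x y
    using chord_cong[OF walk, of "x + d" x "y + d" y] by simp
  then have "crossing L f (p + d) (r + d) (q + d) (s + d)"
    using assms(2) by (simp add: crossing_def)
  then have cross: "crossing L f (p + d) (r + d) (q + d) s'"
    unfolding \<open>s + d = s'\<close> .
  note rotate = crossing_rotate[OF walk]
  consider "i \<le> p + d" | "p + d < i" "i \<le> r + d" | "r + d < i" "i \<le> q + d" | "q + d < i"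
    by linarith
  then show thesis
  proof cases
    case 1
    then show thesis using that cross s' by blast
  next
    case 2
    then show thesis using that[OF _ _ rotate[OF cross]] by simp
  next
    case 3
    then show thesis using that[OF _ _ rotate[OF rotate[OF cross]]] by simp
  next
    case 4
    then show thesis using that[OF _ _ rotate[OF rotate[OF rotate[OF cross]]]] s' by simp
  qed
qed

lemma shortest_closed_walk: "shortest_contradictory_walk L f \<Longrightarrow> closed_walk E L f"
  by (simp add: shortest_contradictory_walk_def)

lemma shortest_no_chord_in_loop:
  assumes "shortest_contradictory_walk L f" "i < j" "j < i + L" "f i = f j"
    and "p \<in> {i..j}" "q \<in> {i..j}"
  shows "\<not> chord f p q"
proof
  assume chord: "chord f p q"
  have "closed_walk E L f"
    using assms(1) by (rule shortest_closed_walk)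
  then obtain g where g: "closed_walk E (j - i) g" "\<forall>k\<in>{i..j}. g k = f k"
    using closed_walk_of_window[OF assms(2), of f E] assms(4) closed_walk_arc by metis
  then have "chord g p q"
    using chord assms(5,6) by (simp add: chord_def)
  with g(1) have "L \<le> j - i"
    using assms(1) unfolding shortest_contradictory_walk_def by blast
  with assms(3) show False by simp
qed

lemma shortest_reflect:
  assumes f: "shortest_contradictory_walk L f" and chord: "chord f p q"
    and ord: "i \<le> p" "p < q" "q < i + L"
  obtains g where "shortest_contradictory_walk L g"
    "\<forall>k\<in>{p..q}. g k = \<sigma> (f (p + q - k))" "\<forall>k\<in>{i..p} \<union> {q..i + L}. g k = f k"
proof -
  have walk: "closed_walk E L f"
    using f by (rule shortest_closed_walk)
  define h where "h = (\<lambda>k. if p \<le> k \<and> k \<le> q then \<sigma> (f (p + q - k)) else f k)"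
  have h_inside: "h k = \<sigma> (f (p + q - k))" if "p \<le> k" "k \<le> q" for k
    using that by (simp add: h_def)
  have "\<sigma> (f p) = f q" "\<sigma> (f q) = f p"
    using chord chord_sym[OF walk, of p q] by (simp_all add: chord_def)
  then have h_outside: "h k = f k" if "k \<le> p \<or> q \<le> k" for k
    using that ord by (cases "k = p"; cases "k = q") (auto simp: h_def)
  have h_arc: "(h k, h (k + 1)) \<in> E" for k
  proof (cases "p \<le> k \<and> k < q")
    case True
    have "(f (p + q - (k + 1)), f (p + q - k)) \<in> E"
      using closed_walk_arc[OF walk, of "p + q - (k + 1)"] by (simp add: algebra_simps)
    then show ?thesis
      using True skew by (simp add: h_inside)
  next
    case False
    then show ?thesis using closed_walk_arc[OF walk, of k] by (auto simp: h_outside)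
  qed
  have "h (i + L) = h i"
    using ord closed_walk_eq[OF walk, of i "i + L"] by (simp add: h_outside)
  then obtain g where g: "closed_walk E L g" "\<forall>k\<in>{i..i + L}. g k = h k"
    using closed_walk_of_window[of i "i + L" h E] h_arc ord by auto
  have "chord g p q"
    using g(2) ord chord by (simp add: chord_def h_outside)
  then have "shortest_contradictory_walk L g"
    using f g(1) unfolding shortest_contradictory_walk_def by blast
  moreover have "\<forall>k\<in>{p..q}. g k = \<sigma> (f (p + q - k))"
    using g(2) ord h_inside by simp
  moreover have "\<forall>k\<in>{i..p} \<union> {q..i + L}. g k = f k"
    using g(2) ord h_outside by auto
  ultimately show thesis
    by (rule that)
qed

text \<open>If a repetition \<open>f i = f j\<close> separates the two chords, reflecting the section between \<open>p\<close> and \<open>q\<close>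
  moves the mate of \<open>f i\<close> into a shorter loop through \<open>f i\<close>.\<close>

lemma shortest_crossing_no_repetition:
  assumes f: "shortest_contradictory_walk L f" and cross: "crossing L f p r q s"
    and ij: "i < j" "j < i + L" and window: "i \<le> p" "s < i + L"
  shows "f i \<noteq> f j"
proof
  assume eq: "f i = f j"
  have walk: "closed_walk E L f"
    using f by (rule shortest_closed_walk)
  have ord: "p < r" "r < q" "q < s" and chords: "chord f p q" "chord f r s"
    using cross by (simp_all add: crossing_def)
  have "f j = f (i + L)"
    using eq closed_walk_eq[OF walk, of i "i + L"] by simp
  then have "\<not> j \<le> r"
    using shortest_no_chord_in_loop[OF f, of j "i + L" r s] chords(2) ord ij window by auto
  moreover have "\<not> q \<le> j"
    using shortest_no_chord_in_loop[OF f ij eq, of p q] chords(1) ord window by auto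
  ultimately have j: "r < j" "j < q"
    by simp_all
  obtain g where g: "shortest_contradictory_walk L g"
    and inside: "\<forall>k\<in>{p..q}. g k = \<sigma> (f (p + q - k))"
    and outside: "\<forall>k\<in>{i..p} \<union> {q..i + L}. g k = f k"
    by (rule shortest_reflect[OF f chords(1) window(1)]) (use ord window in auto)
  have g_eq: "g k = g (k + L)" for k
    using closed_walk_eq[OF shortest_closed_walk[OF g]] by simp
  have "g s = \<sigma> (f r)"
    using outside chords(2) ord window by (simp add: chord_def)
  then have "g s = g (p + q - r + L)"
    using inside ord g_eq[of "p + q - r"] by simp
  then have "\<not> chord g (i + L) (p + q - j + L)"
    using shortest_no_chord_in_loop[OF g, of s "p + q - r + L"] ord j window by simp
  moreover have "g (i + L) = f j"
    using outside ord window \<open>f j = f (i + L)\<close> by simp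
  moreover have "g (p + q - j + L) = \<sigma> (f j)"
    using inside ord j g_eq[of "p + q - j"] by simp
  ultimately show False
    by (simp add: chord_def)
qed

lemma shortest_crossing_simple_cycle:
  assumes f: "shortest_contradictory_walk L f" and cross: "crossing L f p r q s"
  shows "simple_cycle E L f"
proof (rule ccontr)
  have walk: "closed_walk E L f"
    using f by (rule shortest_closed_walk)
  assume "\<not> simple_cycle E L f"
  then obtain i j where ij: "i < j" "j < i + L" "f i = f j"
    by (rule repetition_of_nonsimple[OF walk])
  obtain p' r' q' s' where "i \<le> p'" "s' < i + L" "crossing L f p' r' q' s'"
    by (rule crossing_in_window[OF walk cross])
  then show False
    using shortest_crossing_no_repetition[OF f _ ij(1,2)] ij(3) by blast
qed

lemma ex_shortest_contradictory_walk:
  assumes "contradictory V \<sigma> E"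
  obtains L f where "shortest_contradictory_walk L f"
proof -
  define is_length where "is_length = (\<lambda>n. \<exists>f p q. closed_walk E (int n) f \<and> chord f p q)"
  obtain v where v: "v \<in> V" "(v, \<sigma> v) \<in> E\<^sup>*" "(\<sigma> v, v) \<in> E\<^sup>*"
    using assms by (auto simp: contradictory_def)
  moreover have "v \<noteq> \<sigma> v"
    using mate_neq[OF v(1)] by simp
  ultimately obtain L f p q where "closed_walk E L f" "f p = v" "f q = \<sigma> v"
    using closed_walk_of_rtrancl[of v "\<sigma> v" E] by metis
  then have "is_length (nat L)"
    using closed_walk_length_pos unfolding is_length_def chord_def
    by (metis int_nat_eq order_less_imp_le)
  then have "is_length (LEAST n. is_length n)"
    by (rule LeastI)
  then obtain f p q where f: "closed_walk E (int (LEAST n. is_length n)) f" "chord f p q"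
    unfolding is_length_def by blast
  have "int (LEAST n. is_length n) \<le> M" if "closed_walk E M g" "chord g p q" for M g p q
  proof -
    have "M = int (nat M)"
      using closed_walk_length_pos[OF that(1)] by simp
    then have "is_length (nat M)"
      using that unfolding is_length_def by metis
    then have "(LEAST n. is_length n) \<le> nat M"
      by (rule Least_le)
    then show ?thesis
      using closed_walk_length_pos[OF that(1)] by linarith
  qed
  with f show thesis
    using that unfolding shortest_contradictory_walk_def by blast
qed

lemma shortest_repetition_separates_chord:
  assumes f: "shortest_contradictory_walk L f" and chord: "chord f p q"
    and ij: "i < j" "j < i + L" "f i = f j" and window: "i \<le> p" "p < q" "q < i + L"
  shows "i < p" "p < j" "j < q"
proof -
  have f_end: "f j = f (i + L)"
    using ij(3) closed_walk_eq[OF shortest_closed_walk[OF f], of i "i + L"] by simp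
  note no_chord = shortest_no_chord_in_loop[OF f]
  have "\<not> q \<le> j"
    using no_chord[OF ij, of p q] chord window by auto
  then show "j < q"
    by simp
  have "\<not> j \<le> p"
    using no_chord[of j "i + L" p q] chord window ij f_end by auto
  then show "p < j"
    by simp
  have "p \<noteq> i"
    using no_chord[of j "i + L" "i + L" q] chord window ij f_end \<open>j < q\<close> by (auto simp: chord_def)
  then show "i < p"
    using window(1) by simp
qed

text \<open>A shortest contradictory closed walk need not be simple, but if it is not, then reflecting it
  between the ends of a chord creates two crossing chords.\<close>

lemma ex_simple_contradictory_cycle:
  assumes "contradictory V \<sigma> E"
  obtains L b p q where "simple_cycle E L b" "chord b p q"
proof -
  obtain L f where f: "shortest_contradictory_walk L f"
    using ex_shortest_contradictory_walk[OF assms] .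
  then have walk: "closed_walk E L f"
    by (rule shortest_closed_walk)
  obtain p q where chord: "chord f p q"
    using f by (auto simp: shortest_contradictory_walk_def)
  show thesis
  proof (cases "simple_cycle E L f")
    case True
    then show thesis using chord by (rule that)
  next
    case False
    then obtain i j where ij: "i < j" "j < i + L" "f i = f j"
      by (rule repetition_of_nonsimple[OF walk])
    obtain p q where pq: "i \<le> p" "p < q" "q < i + L" "chord f p q"
      by (rule chord_in_window[OF walk chord])
    have ord: "i < p" "p < j" "j < q"
      using shortest_repetition_separates_chord[OF f pq(4) ij pq(1-3)] .
    obtain g where g: "shortest_contradictory_walk L g"
      and inside: "\<forall>k\<in>{p..q}. g k = \<sigma> (f (p + q - k))"
      and outside: "\<forall>k\<in>{i..p} \<union> {q..i + L}. g k = f k"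
      by (rule shortest_reflect[OF f pq(4,1-3)]) blast
    have "chord g i (p + q - j)"
      using inside outside ord ij(3) by (simp add: chord_def)
    moreover have chord_g: "chord g p q"
      using outside ord pq by (simp add: chord_def)
    ultimately have "crossing L g i p (p + q - j) q"
      using ord pq by (simp add: crossing_def)
    then show thesis
      using that shortest_crossing_simple_cycle[OF g] chord_g by blast
  qed
qed


subsection \<open>Mirror images of cycles\<close>

definition mirror :: "(int \<Rightarrow> 'a) \<Rightarrow> int \<Rightarrow> 'a" where
  "mirror f = (\<lambda>i. \<sigma> (f (- i)))"

lemma walk_arcs_mirror: "walk_arcs (mirror f) = (\<lambda>(u, w). (\<sigma> w, \<sigma> u)) ` walk_arcs f"
proof -
  have "walk_arcs (mirror f) = range (\<lambda>i. (\<sigma> (f (- i)), \<sigma> (f (- (i + 1)))))"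
    by (simp add: walk_arcs_def mirror_def)
  also have "\<dots> = (\<lambda>i. (\<sigma> (f (i + 1)), \<sigma> (f i))) ` range (\<lambda>i. - (i + 1))"
    unfolding image_image by simp
  also have "range (\<lambda>i :: int. - (i + 1)) = UNIV"
    by (rule surjI[of _ "\<lambda>i. - (i + 1)"]) simp
  finally show ?thesis
    by (simp add: walk_arcs_def image_image)
qed

lemma walk_arcs_mirror_subset: "walk_arcs f \<subseteq> E \<Longrightarrow> walk_arcs (mirror f) \<subseteq> E"
  unfolding walk_arcs_mirror by (auto intro: skew)

lemma simple_cycle_mirror:
  assumes "simple_cycle E L b"
  shows "simple_cycle E L (mirror b)"
proof -
  have walk: "closed_walk E L b"
    using assms by (rule simple_cycle_closed_walk)
  have "mirror b i = mirror b j \<longleftrightarrow> L dvd j - i" for i j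
  proof -
    have "mirror b i = mirror b j \<longleftrightarrow> b (- i) = b (- j)"
      using mate_mate closed_walk_in_V[OF walk] unfolding mirror_def by metis
    also have "\<dots> \<longleftrightarrow> L dvd i - j"
      unfolding simple_cycle_eq_iff[OF assms] by simp
    finally show ?thesis
      by (simp only: dvd_diff_commute)
  qed
  moreover have "walk_arcs (mirror b) \<subseteq> E"
    using walk walk_arcs_mirror_subset by (simp only: closed_walk_def)
  ultimately show ?thesis
    using closed_walk_length_pos[OF walk] unfolding simple_cycle_def closed_walk_def by blast
qed

end


section \<open>Minimally contradictory digraphs\<close>

locale min_contradictory_digraph = skew_digraph +
  assumes finite_V: "finite V"
    and no_isolated: "V \<subseteq> Field E"
    and no_mate_arc: "(v, \<sigma> v) \<notin> E"
    and contradictory: "contradictory V \<sigma> E"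
    and minimal: "(u, w) \<in> E \<Longrightarrow> \<not> contradictory V \<sigma> (E - {(u, w), (\<sigma> w, \<sigma> u)})"
begin

lemma arcs_eq_walk_Un_mirror:
  assumes walk: "closed_walk E L f" and "chord f p q"
  shows "E = walk_arcs f \<union> walk_arcs (mirror f)"
proof
  show "walk_arcs f \<union> walk_arcs (mirror f) \<subseteq> E"
    using walk walk_arcs_mirror_subset by (simp only: closed_walk_def Un_subset_iff)
  show "E \<subseteq> walk_arcs f \<union> walk_arcs (mirror f)"
  proof (rule ccontr)
    assume "\<not> E \<subseteq> walk_arcs f \<union> walk_arcs (mirror f)"
    then obtain u w where uw: "(u, w) \<in> E" "(u, w) \<notin> walk_arcs f" "(u, w) \<notin> walk_arcs (mirror f)"
      by auto
    have "(\<sigma> w, \<sigma> u) \<notin> walk_arcs f"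
    proof
      assume "(\<sigma> w, \<sigma> u) \<in> walk_arcs f"
      then have "(\<sigma> (\<sigma> u), \<sigma> (\<sigma> w)) \<in> walk_arcs (mirror f)"
        unfolding walk_arcs_mirror by force
      with uw show False
        using arc_in_V[OF uw(1)] by simp
    qed
    with uw(2) have "closed_walk (E - {(u, w), (\<sigma> w, \<sigma> u)}) L f"
      using walk unfolding closed_walk_def by blast
    then have "contradictory V \<sigma> (E - {(u, w), (\<sigma> w, \<sigma> u)})"
      using closed_walk_rtrancl closed_walk_in_V[OF walk] assms(2)
      unfolding contradictory_def chord_def by metis
    with minimal[OF uw(1)] show False ..
  qed
qed

lemma vertices_eq_walk_Un_mates:
  assumes walk: "closed_walk E L f" and "chord f p q"
  shows "V = range f \<union> \<sigma> ` range f"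
proof
  show "range f \<union> \<sigma> ` range f \<subseteq> V"
    using closed_walk_in_V[OF walk] by auto
  have "Field (walk_arcs f \<union> walk_arcs (mirror f)) \<subseteq> range f \<union> \<sigma> ` range f"
    by (auto simp: Field_def walk_arcs_def mirror_def)
  then have "Field E \<subseteq> range f \<union> \<sigma> ` range f"
    by (simp only: arcs_eq_walk_Un_mirror[OF assms, symmetric])
  with no_isolated show "V \<subseteq> range f \<union> \<sigma> ` range f"
    by (rule subset_trans)
qed

lemma ex_chord_iff_length:
  assumes cycle: "simple_cycle E L b"
  shows "(\<exists>p q. chord b p q) \<longleftrightarrow> int (card V) < 2 * L"
proof -
  have in_V: "b i \<in> V" for i
    using closed_walk_in_V[OF simple_cycle_closed_walk[OF cycle]] .
  have fin: "finite (range b)" "finite (\<sigma> ` range b)"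
    using card_range_simple_cycle(1)[OF cycle] by simp_all
  have "inj_on \<sigma> (range b)"
    by (rule inj_on_inverseI[of _ \<sigma>]) (auto simp: in_V)
  then have "int (card (range b)) + int (card (\<sigma> ` range b)) = 2 * L"
    using card_range_simple_cycle(2)[OF cycle] by (simp add: card_image)
  then have card: "2 * L = int (card (range b \<union> \<sigma> ` range b)) + int (card (range b \<inter> \<sigma> ` range b))"
    using card_Un_Int[OF fin] by linarith
  have chord_iff: "(\<exists>p q. chord b p q) \<longleftrightarrow> range b \<inter> \<sigma> ` range b \<noteq> {}"
    by (auto simp: chord_def)
  show ?thesis
  proof
    assume chord: "\<exists>p q. chord b p q"
    then have "V = range b \<union> \<sigma> ` range b"
      using vertices_eq_walk_Un_mates[OF simple_cycle_closed_walk[OF cycle]] by blast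
    moreover have "0 < card (range b \<inter> \<sigma> ` range b)"
      using chord chord_iff fin by (simp add: card_gt_0_iff)
    ultimately show "int (card V) < 2 * L"
      using card by simp
  next
    assume less: "int (card V) < 2 * L"
    have "card (range b \<union> \<sigma> ` range b) \<le> card V"
      using finite_V in_V by (intro card_mono) auto
    then have "card (range b \<inter> \<sigma> ` range b) \<noteq> 0"
      using card less by linarith
    then show "\<exists>p q. chord b p q"
      unfolding chord_iff by force
  qed
qed

lemma no_middle_chord:
  assumes walk: "closed_walk E L f"
  shows "\<not> chord f (i + (a - i) div 2) (a - (a - i) div 2)"
proof -
  define k where "k = (a - i) div 2"
  consider "a - k = i + k" | "a - k = i + k + 1"
    unfolding k_def by linarith
  then have "\<not> chord f (i + k) (a - k)"
  proof cases
    case 1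
    then show ?thesis using chord_irrefl[OF walk] by metis
  next
    case 2
    then show ?thesis
      using no_mate_arc closed_walk_arc[OF walk, of "i + k"] unfolding chord_def by metis
  qed
  then show ?thesis
    unfolding k_def .
qed

lemma mirror_not_on_cycle:
  assumes "simple_cycle E L b"
  shows "\<not> walk_arcs (mirror b) \<subseteq> walk_arcs b"
proof
  assume "walk_arcs (mirror b) \<subseteq> walk_arcs b"
  then obtain k where "\<forall>i. mirror b i = b (i + k)"
    by (rule rotation_of_walk_arcs_subset[OF assms
        simple_cycle_closed_walk[OF simple_cycle_mirror[OF assms]]])
  from this[rule_format, of "- (k div 2)"] show False
    using no_middle_chord[OF simple_cycle_closed_walk[OF assms], of 0 k]
    by (simp add: chord_def mirror_def)
qed

end


subsection \<open>Chords of a contradictory cycle\<close>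

locale contradictory_cycle = min_contradictory_digraph +
  fixes L :: int and b :: "int \<Rightarrow> 'a"
  assumes cycle: "simple_cycle E L b"
    and ex_chord: "\<exists>p q. chord b p q"
begin

lemma cycle_walk: "closed_walk E L b"
  using cycle by (rule simple_cycle_closed_walk)

lemma cycle_length_pos: "0 < L"
  using cycle_walk by (rule closed_walk_length_pos)

text \<open>Were the mirror image of the arc leaving \<open>b p\<close> off the cycle, that arc could be removed: the mirror
  image of the section from \<open>i\<close> to \<open>j\<close> bypasses it.\<close>

lemma noncrossing_chords_mirror_arc:
  assumes ord: "i \<le> j" "j \<le> j'" "i' \<le> i + L" and p: "j' \<le> p" "p < i'"
    and chords: "chord b i i'" "chord b j j'"
  shows "(\<sigma> (b (p + 1)), \<sigma> (b p)) \<in> walk_arcs b"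
proof (rule ccontr)
  assume off_cycle: "(\<sigma> (b (p + 1)), \<sigma> (b p)) \<notin> walk_arcs b"
  define R where "R = E - {(b p, b (p + 1)), (\<sigma> (b (p + 1)), \<sigma> (b p))}"
  interpret R: skew_digraph V R \<sigma>
    unfolding R_def using closed_walk_arc[OF cycle_walk] by (rule skew_digraph_remove_arc)
  have arc: "(b k, b (k + 1)) \<in> R" if "i \<le> k \<and> k < j' \<or> i' \<le> k \<and> k < i + L" for k
  proof -
    have "\<not> L dvd p - k"
      using that p ord zdvd_not_zless[of "\<bar>p - k\<bar>" L] by (auto simp: abs_if)
    then have "b k \<noteq> b p"
      by (simp add: simple_cycle_eq_iff[OF cycle])
    moreover have "(b k, b (k + 1)) \<noteq> (\<sigma> (b (p + 1)), \<sigma> (b p))"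
      using off_cycle arc_in_walk_arcs[of b k] by metis
    ultimately show ?thesis
      using closed_walk_arc[OF cycle_walk, of k] by (simp add: R_def)
  qed
  have "(b i, b j) \<in> R\<^sup>*" and j_j': "(b j, b j') \<in> R\<^sup>*" and "(b i', b (i + L)) \<in> R\<^sup>*"
    using ord p by (auto intro!: rtrancl_segment arc)
  moreover have "b (i + L) = b i"
    using closed_walk_eq[OF cycle_walk, of i "i + L"] by simp
  moreover have "(\<sigma> (b j), b i') \<in> R\<^sup>*"
    using R.rtrancl_skew[OF \<open>(b i, b j) \<in> R\<^sup>*\<close>] chords(1) by (simp add: chord_def)
  ultimately have "(\<sigma> (b j), b j) \<in> R\<^sup>*"
    by (metis rtrancl_trans)
  moreover have "(b j, \<sigma> (b j)) \<in> R\<^sup>*"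
    using j_j' chords(2) by (simp add: chord_def)
  ultimately have "contradictory V \<sigma> R"
    using closed_walk_in_V[OF cycle_walk] by (auto simp: contradictory_def)
  then show False
    using minimal[OF closed_walk_arc[OF cycle_walk, of p]] by (simp add: R_def)
qed

lemma noncrossing_chords:
  assumes ord: "i \<le> j" "j \<le> j'" "i' \<le> i + L" and t: "0 \<le> t" "t \<le> i' - j'"
    and chords: "chord b i i'" "chord b j j'"
  shows "chord b (i + t) (i' - t)"
  using t
proof (induction t rule: int_ge_induct)
  case base
  then show ?case using chords(1) by simp
next
  case (step t)
  have "(\<sigma> (b (i' - t)), \<sigma> (b (i' - (t + 1)))) \<in> walk_arcs b"
    using noncrossing_chords_mirror_arc[OF ord _ _ chords, of "i' - (t + 1)"] step by simp
  moreover have "\<sigma> (b (i' - t)) = b (i + t)"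
    using step chord_sym[OF cycle_walk, of "i + t" "i' - t"] by (simp add: chord_def)
  ultimately have "\<sigma> (b (i' - (t + 1))) = b (i + t + 1)"
    by (rule simple_cycle_successor[OF cycle])
  then have "chord b (i' - (t + 1)) (i + (t + 1))"
    by (simp add: chord_def add.assoc)
  then show ?case
    using chord_sym[OF cycle_walk] by blast
qed

lemma chord_shift_multiple:
  assumes shift: "\<And>i a. chord b i a \<Longrightarrow> chord b (i + c) (a - c)" and chord: "chord b i a"
  shows "chord b (i + c * t) (a - c * t)"
proof (induction t rule: int_induct[of _ 0])
  case base
  then show ?case using chord by simp
next
  case (step1 t)
  then show ?case using shift[of "i + c * t" "a - c * t"] by (simp add: algebra_simps)
next
  case (step2 t)
  then have "chord b (a - c * t + c) (i + c * t - c)"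
    using shift chord_sym[OF cycle_walk] by blast
  then show ?case
    using chord_sym[OF cycle_walk] by (simp add: algebra_simps)
qed

lemma chord_shift_gcd:
  assumes shift: "\<And>i a. chord b i a \<Longrightarrow> chord b (i + c) (a - c)" and chord: "chord b i a"
  shows "chord b (i + gcd c L * t) (a - gcd c L * t)"
proof -
  obtain x y where "x * c + y * L = gcd c L"
    using bezout_int by blast
  then have "gcd c L * t = c * (x * t) + L * (y * t)"
    by (metis distrib_right mult.assoc mult.commute)
  then show ?thesis
    using chord_shift_multiple[OF assms, of "x * t"]
      chord_cong[OF cycle_walk, of "i + c * (x * t)" "i + gcd c L * t"
        "a - c * (x * t)" "a - gcd c L * t"]
    by simp
qed

lemma no_long_shiftable_chord:
  assumes shift: "\<And>i a t. chord b i a \<Longrightarrow> chord b (i + g * t) (a - g * t)"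
    and "0 < g" "2 * g \<le> a - i" "a - i \<le> L"
  shows "\<not> chord b i a"
proof
  assume chord: "chord b i a"
  define t where "t = (a - i) div 2"
  have "chord b (i + g) (a - g)"
    using shift[OF chord, of 1] by simp
  then have "chord b (i + t mod g) (a - t mod g)"
    using noncrossing_chords[OF _ _ _ _ _ chord, of "i + g" "a - g" "t mod g"]
      assms(3,4) \<open>0 < g\<close> order_less_imp_le[OF pos_mod_bound[OF \<open>0 < g\<close>, of t]] by simp
  from shift[OF this, of "t div g"] have "chord b (i + t) (a - t)"
    by (simp add: add.assoc diff_diff_eq)
  then show False
    using no_middle_chord[OF cycle_walk] by (simp add: t_def)
qed

lemma ex_long_shifted_chord:
  assumes shift: "\<And>i a t. chord b i a \<Longrightarrow> chord b (i + g * t) (a - g * t)"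
    and "0 < g" "L = g * m" "3 \<le> m"
  obtains i a where "chord b i a" "2 * g \<le> a - i" "a - i \<le> L"
proof -
  obtain i a where chord: "chord b i a"
    using ex_chord by blast
  consider "m = 3" | "4 \<le> m"
    using assms(4) by linarith
  then show thesis
  proof cases
    case 1
    define q where "q = (a - i) div g - 2"
    have "chord b (i + g * (2 * q)) (a - g * (2 * q) + L * q)"
      using shift[OF chord, of "2 * q"]
        chord_cong[OF cycle_walk, of "i + g * (2 * q)" "i + g * (2 * q)"
          "a - g * (2 * q) + L * q" "a - g * (2 * q)"] by simp
    moreover have "a - g * (2 * q) + L * q - (i + g * (2 * q)) = (a - i) mod g + 2 * g"
      using minus_div_mult_eq_mod[of "a - i" g] by (simp add: q_def assms(3) 1 algebra_simps)
    moreover have "L = 3 * g"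
      using assms(3) 1 by simp
    ultimately show thesis
      using that[of "i + g * (2 * q)" "a - g * (2 * q) + L * q"] \<open>0 < g\<close>
        pos_mod_bound[of g "a - i"] pos_mod_sign[of g "a - i"] by linarith
  next
    case 2
    define t where "t = (a - i) div (2 * g) - 1"
    have "a - g * t - (i + g * t) = (a - i) mod (2 * g) + 2 * g"
      using minus_div_mult_eq_mod[of "a - i" "2 * g"] by (simp add: t_def algebra_simps)
    moreover have "4 * g \<le> L"
      using 2 \<open>0 < g\<close> assms(3) by (simp add: mult.commute)
    ultimately show thesis
      using that[OF shift[OF chord, of t]] \<open>0 < g\<close> pos_mod_bound[of "2 * g" "a - i"]
        pos_mod_sign[of "2 * g" "a - i"] by linarith
  qed
qed

lemma cycle_length_dvd_double_chord_shift:
  assumes shift: "\<And>i a. chord b i a \<Longrightarrow> chord b (i + c) (a - c)"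
  shows "L dvd 2 * c"
proof (rule ccontr)
  assume "\<not> L dvd 2 * c"
  define g where "g = gcd c L"
  have shift_gcd: "chord b (i + g * t) (a - g * t)" if "chord b i a" for i a t
    unfolding g_def using shift that by (rule chord_shift_gcd)
  have "0 < g"
    using cycle_length_pos by (simp add: g_def)
  obtain m where m: "L = g * m"
    unfolding g_def by (meson dvd_def gcd_dvd2)
  have "\<not> L dvd 2 * g"
    using \<open>\<not> L dvd 2 * c\<close> unfolding g_def by (meson dvd_trans gcd_dvd1 mult_dvd_mono dvd_refl)
  then have "m \<noteq> 1" "m \<noteq> 2" "0 < m"
    using m cycle_length_pos \<open>0 < g\<close> by (auto simp: zero_less_mult_iff)
  then have "3 \<le> m"
    by linarith
  then obtain i a where "chord b i a" "2 * g \<le> a - i" "a - i \<le> L"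
    using ex_long_shifted_chord[OF shift_gcd \<open>0 < g\<close> m] by blast
  then show False
    using no_long_shiftable_chord[OF shift_gcd \<open>0 < g\<close>] by blast
qed

lemma ex_long_chord:
  obtains i a where "chord b i a" "L \<le> 2 * (a - i)" "a - i \<le> L"
proof -
  obtain p q where "chord b p q"
    using ex_chord by blast
  then obtain i a where ia: "0 \<le> i" "i < a" "a < 0 + L" "chord b i a"
    by (rule chord_in_window[OF cycle_walk])
  show thesis
  proof (cases "L \<le> 2 * (a - i)")
    case True
    then show ?thesis using that ia by simp
  next
    case False
    moreover have "chord b a (i + L)"
      using ia(4) chord_sym[OF cycle_walk] chord_cong[OF cycle_walk, of a a "i + L" i] by simp
    ultimately show ?thesis
      using that ia by simp
  qed
qed

end


section \<open>Uniqueness of the skew-symmetry\<close>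

locale contradictory_cycle_pair =
  S: contradictory_cycle V E \<sigma> L b + T: min_contradictory_digraph V E \<tau>
  for V :: "'a set" and E \<sigma> \<tau> L b

sublocale contradictory_cycle_pair \<subseteq> T: contradictory_cycle V E \<tau> L b
proof
  show "\<exists>p q. T.chord b p q"
    using S.ex_chord_iff_length[OF S.cycle] T.ex_chord_iff_length[OF S.cycle] S.ex_chord by simp
qed (rule S.cycle)

context contradictory_cycle_pair
begin

lemma mates_differ_by_rotation:
  obtains c where "\<forall>i. \<tau> (b i) = \<sigma> (b (i + c))"
proof -
  have "walk_arcs b \<union> walk_arcs (S.mirror b) = walk_arcs b \<union> walk_arcs (T.mirror b)"
    using S.arcs_eq_walk_Un_mirror[OF S.cycle_walk] T.arcs_eq_walk_Un_mirror[OF S.cycle_walk]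
      S.ex_chord T.ex_chord by metis
  then obtain k where "\<forall>i. T.mirror b i = S.mirror b (i + k)"
    by (rule rotation_of_walk_arcs_Un_eq[OF S.cycle S.simple_cycle_mirror[OF S.cycle]
          T.simple_cycle_mirror[OF S.cycle] _ S.mirror_not_on_cycle[OF S.cycle]])
  then have "\<tau> (b (- (- i))) = \<sigma> (b (- (- i + k)))" for i
    unfolding S.mirror_def T.mirror_def by blast
  then have "\<tau> (b i) = \<sigma> (b (i + (- k)))" for i
    by simp
  then show thesis
    using that by blast
qed

context
  fixes c
  assumes rotation: "\<And>i. \<tau> (b i) = \<sigma> (b (i + c))"
begin

lemma T_chord_of_chord:
  assumes "S.chord b i a"
  shows "T.chord b i (a - c)"
proof -
  have "T.chord b (a - c) i"
    using rotation[of "a - c"] assms S.chord_sym[OF S.cycle_walk, of i a]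
    by (simp add: S.chord_def T.chord_def)
  then show ?thesis
    using T.chord_sym[OF S.cycle_walk] by blast
qed

lemma chord_shift:
  assumes "S.chord b i a"
  shows "S.chord b (i + c) (a - c)"
  using T_chord_of_chord[OF assms] rotation[of i] unfolding S.chord_def T.chord_def by metis

lemma rotation_trivial: "L dvd c"
proof (rule ccontr)
  assume "\<not> L dvd c"
  obtain q where q: "2 * c = L * q"
    using S.cycle_length_dvd_double_chord_shift[OF chord_shift] by blast
  have "odd q"
  proof
    assume "even q"
    then have "c = L * (q div 2)"
      using q by auto
    with \<open>\<not> L dvd c\<close> show False
      by simp
  qed
  then obtain p where p: "q = 2 * p + 1"
    by (rule oddE)
  then have "even L"
    using q by (metis dvd_triv_left even_mult_iff odd_two_times_div_two_succ \<open>odd q\<close>)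
  then obtain g where L: "L = 2 * g"
    by blast
  have c: "c = g + L * p"
    using q unfolding p L by (simp add: algebra_simps)
  obtain i a where chord: "S.chord b i a" and ia: "L \<le> 2 * (a - i)" "a - i \<le> L"
    by (rule S.ex_long_chord)
  have "S.chord b (a - g) (i + g)"
    using chord_shift[OF chord] S.chord_sym[OF S.cycle_walk]
      S.chord_cong[OF S.cycle_walk, of "a - c" "a - g" "i + c" "i + g"] by (simp add: c)
  define t where "t = (a - g - i) div 2"
  have "S.chord b (i + t) (a - t)"
    using S.noncrossing_chords[of i "a - g" "i + g" a t] \<open>S.chord b (a - g) (i + g)\<close> chord ia L
    unfolding t_def by simp
  then have "T.chord b (i + t) (a - t - c)"
    by (rule T_chord_of_chord)
  then have "T.chord b (i + t) (a - g - t)"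
    using T.chord_cong[OF S.cycle_walk, of "i + t" "i + t" "a - t - c" "a - g - t"] by (simp add: c)
  then show False
    using T.no_middle_chord[OF S.cycle_walk, of i "a - g"] by (simp add: t_def)
qed

end

lemma mates_eq:
  assumes "v \<in> V"
  shows "\<tau> v = \<sigma> v"
proof -
  obtain c where c: "\<forall>i. \<tau> (b i) = \<sigma> (b (i + c))"
    by (rule mates_differ_by_rotation)
  then have "L dvd c"
    using rotation_trivial by blast
  then have on_cycle: "\<tau> (b i) = \<sigma> (b i)" for i
    using c closed_walk_eq[OF S.cycle_walk, of i "i + c"] by simp
  have "V = range b \<union> \<sigma> ` range b"
    using S.vertices_eq_walk_Un_mates[OF S.cycle_walk] S.ex_chord by blast
  then consider i where "v = b i" | i where "v = \<sigma> (b i)"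
    using assms by blast
  then show ?thesis
  proof cases
    case 1
    then show ?thesis using on_cycle by simp
  next
    case 2
    then show ?thesis
      using on_cycle S.mate_mate T.mate_mate S.closed_walk_in_V[OF S.cycle_walk] by metis
  qed
qed

end

lemma skew_symmetry_unique:
  assumes "min_contradictory_digraph V E \<sigma>" "min_contradictory_digraph V E \<tau>" "v \<in> V"
  shows "\<tau> v = \<sigma> v"
proof -
  interpret S: min_contradictory_digraph V E \<sigma> by fact
  interpret T: min_contradictory_digraph V E \<tau> by fact
  obtain L b p q where "simple_cycle E L b" "S.chord b p q"
    using S.ex_simple_contradictory_cycle[OF S.contradictory] .
  then interpret contradictory_cycle_pair V E \<sigma> \<tau> L b
    by unfold_locales blast+
  show ?thesis
    using assms(3) by (rule mates_eq)
qed


section \<open>Isomorphisms of minimally contradictory digraphs\<close>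

lemma Field_map_prod: "Field (map_prod f f ` E) = f ` Field E"
  by (force simp: Field_def)

lemma rtrancl_map_prod_iff:
  assumes "inj_on f V" "E \<subseteq> V \<times> V" "u \<in> V" "w \<in> V"
  shows "(f u, f w) \<in> (map_prod f f ` E)\<^sup>* \<longleftrightarrow> (u, w) \<in> E\<^sup>*"
proof
  assume "(u, w) \<in> E\<^sup>*"
  then show "(f u, f w) \<in> (map_prod f f ` E)\<^sup>*"
    by (induction rule: rtrancl_induct) (auto intro: rtrancl_into_rtrancl)
next
  assume "(f u, f w) \<in> (map_prod f f ` E)\<^sup>*"
  moreover have "\<exists>y\<in>V. x = f y \<and> (u, y) \<in> E\<^sup>*" if "(f u, x) \<in> (map_prod f f ` E)\<^sup>*" for x
    using that
  proof (induction rule: rtrancl_induct)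
    case base
    then show ?case using assms(3) by blast
  next
    case (step x z)
    then obtain y y' z' where "y \<in> V" "x = f y" "(u, y) \<in> E\<^sup>*" "(y', z') \<in> E" "x = f y'" "z = f z'"
      by auto
    moreover from this have "y = y'" "z' \<in> V"
      using assms(1,2) by (auto dest: inj_onD)
    ultimately show ?case
      by (intro bexI[of _ z']) (auto intro: rtrancl_into_rtrancl)
  qed
  ultimately obtain y where "y \<in> V" "f w = f y" "(u, y) \<in> E\<^sup>*"
    by blast
  then show "(u, w) \<in> E\<^sup>*"
    using assms(1,4) by (metis inj_onD)
qed

lemma contradictory_map_prod_iff:
  assumes "inj_on f V" "E \<subseteq> V \<times> V"
    and "\<And>v. v \<in> V \<Longrightarrow> \<tau> v \<in> V" "\<And>v. v \<in> V \<Longrightarrow> f (\<tau> v) = \<sigma> (f v)"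
  shows "contradictory (f ` V) \<sigma> (map_prod f f ` E) \<longleftrightarrow> contradictory V \<tau> E"
proof -
  have "(f v, \<sigma> (f v)) \<in> (map_prod f f ` E)\<^sup>* \<longleftrightarrow> (v, \<tau> v) \<in> E\<^sup>*"
    and "(\<sigma> (f v), f v) \<in> (map_prod f f ` E)\<^sup>* \<longleftrightarrow> (\<tau> v, v) \<in> E\<^sup>*" if "v \<in> V" for v
    using rtrancl_map_prod_iff[OF assms(1,2)] that assms(3,4) by metis+
  then show ?thesis
    by (simp add: contradictory_def)
qed

lemma skew_digraph_pullback:
  assumes image: "skew_digraph (f ` V) (map_prod f f ` E) \<sigma>"
    and inj: "inj_on f V" and E: "E \<subseteq> V \<times> V"
    and closed: "\<And>v. v \<in> V \<Longrightarrow> \<tau> v \<in> V" and commutes: "\<And>v. v \<in> V \<Longrightarrow> f (\<tau> v) = \<sigma> (f v)"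
  shows "skew_digraph V E \<tau>"
proof
  interpret image: skew_digraph "f ` V" "map_prod f f ` E" \<sigma> by fact
  have f_eq_iff: "f u = f w \<longleftrightarrow> u = w" if "u \<in> V" "w \<in> V" for u w
    using inj that by (rule inj_on_eq_iff)
  show "\<tau> (\<tau> v) = v" if "v \<in> V" for v
    using that image.mate_mate[of "f v"] by (simp add: closed commutes flip: f_eq_iff)
  show "\<tau> v \<noteq> v" if "v \<in> V" for v
    using that image.mate_neq[of "f v"] commutes[of v] by auto
  show "(\<tau> w, \<tau> u) \<in> E" if uw: "(u, w) \<in> E" for u w
  proof -
    have "u \<in> V" "w \<in> V"
      using uw E by auto
    then have "(f (\<tau> w), f (\<tau> u)) \<in> map_prod f f ` E"
      using image.skew[of "f u" "f w"] uw by (auto simp: commutes)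
    then obtain x y where "(x, y) \<in> E" "f (\<tau> w) = f x" "f (\<tau> u) = f y"
      by auto
    moreover from this have "x \<in> V" "y \<in> V"
      using E by auto
    ultimately show ?thesis
      using f_eq_iff closed \<open>u \<in> V\<close> \<open>w \<in> V\<close> by metis
  qed
qed (use E closed in auto)

lemma min_contradictory_digraph_pullback:
  assumes image: "min_contradictory_digraph (f ` V) (map_prod f f ` E) \<sigma>"
    and inj: "inj_on f V" and E: "E \<subseteq> V \<times> V"
    and closed: "\<And>v. v \<in> V \<Longrightarrow> \<tau> v \<in> V" and commutes: "\<And>v. v \<in> V \<Longrightarrow> f (\<tau> v) = \<sigma> (f v)"
  shows "min_contradictory_digraph V E \<tau>"
proof -
  interpret image: min_contradictory_digraph "f ` V" "map_prod f f ` E" \<sigma> by fact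
  interpret skew_digraph V E \<tau>
    using image.skew_digraph_axioms inj E closed commutes by (rule skew_digraph_pullback)
  show ?thesis
  proof
    show "finite V"
      using image.finite_V inj by (simp add: finite_image_iff)
    show "V \<subseteq> Field E"
    proof
      fix v assume "v \<in> V"
      then obtain u where "u \<in> Field E" "f v = f u"
        using image.no_isolated unfolding Field_map_prod by blast
      moreover from this have "u \<in> V"
        using E by (auto simp: Field_def)
      ultimately show "v \<in> Field E"
        using inj_onD[OF inj] \<open>v \<in> V\<close> by metis
    qed
    show "(v, \<tau> v) \<notin> E" for v
    proof
      assume arc: "(v, \<tau> v) \<in> E"
      then have "(f v, f (\<tau> v)) \<in> map_prod f f ` E"
        by (rule map_prod_imageI)
      then show False
        using image.no_mate_arc commutes[OF arc_in_V(1)[OF arc]] by simp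
    qed
    show "contradictory V \<tau> E"
      using image.contradictory contradictory_map_prod_iff[where \<tau> = \<tau>, OF inj E closed commutes] by simp
    show "\<not> contradictory V \<tau> (E - {(u, w), (\<tau> w, \<tau> u)})" if uw: "(u, w) \<in> E" for u w
    proof -
      have V: "u \<in> V" "w \<in> V"
        using uw by (fact arc_in_V)+
      let ?R = "E - {(u, w), (\<tau> w, \<tau> u)}"
      have "map_prod f f ` ?R = map_prod f f ` E - map_prod f f ` {(u, w), (\<tau> w, \<tau> u)}"
        using map_prod_inj_on[OF inj inj] E V by (intro inj_on_image_set_diff) auto
      then have "\<not> contradictory (f ` V) \<sigma> (map_prod f f ` ?R)"
        using image.minimal[of "f u" "f w"] uw V by (auto simp: commutes)
      moreover have "?R \<subseteq> V \<times> V"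
        using E by blast
      ultimately show ?thesis
        using contradictory_map_prod_iff[where \<tau> = \<tau>, OF inj _ closed commutes] by blast
    qed
  qed
qed

lemma min_contradictory_digraph_iso_commutes:
  assumes G: "min_contradictory_digraph V E \<sigma>" and H: "min_contradictory_digraph V' E' \<sigma>'"
    and bij: "bij_betw f V V'" and arcs: "map_prod f f ` E = E'" and v: "v \<in> V"
  shows "f (\<sigma> v) = \<sigma>' (f v)"
proof -
  interpret G: min_contradictory_digraph V E \<sigma> by fact
  interpret H: min_contradictory_digraph V' E' \<sigma>' by fact
  have V': "V' = f ` V" and inj: "inj_on f V"
    using bij by (auto simp: bij_betw_def)
  define \<tau> where "\<tau> = (\<lambda>u. inv_into V f (\<sigma>' (f u)))"
  have mate_in_image: "\<sigma>' (f u) \<in> f ` V" if "u \<in> V" for u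
    using H.mate_in_V[of "f u"] that unfolding V' by blast
  have closed: "\<tau> u \<in> V" and commutes: "f (\<tau> u) = \<sigma>' (f u)" if "u \<in> V" for u
    using mate_in_image[OF that] by (simp_all add: \<tau>_def inv_into_into f_inv_into_f)
  have "min_contradictory_digraph V E \<tau>"
    using H[folded arcs, unfolded V'] inj G.arcs_subset closed commutes
    by (rule min_contradictory_digraph_pullback)
  then have "\<tau> v = \<sigma> v"
    using G v skew_symmetry_unique by metis
  then show ?thesis
    using commutes[OF v] by simp
qed


section \<open>Minimally unsatisfiable 2-CNFs\<close>

lemma complement_complement [simp]: "complement (complement x) = x"
  by (cases x) simp_all

lemma complement_neq [simp]: "complement x \<noteq> x"
  by (cases x) simp_all

lemma var_of_complement [simp]: "var_of (complement x) = var_of x"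
  by (cases x) simp_all

lemma var_of_eq_iff: "var_of x = var_of y \<longleftrightarrow> x = y \<or> x = complement y"
  by (cases x; cases y) auto

lemma lit_true_complement [simp]: "lit_true \<phi> (complement x) \<longleftrightarrow> \<not> lit_true \<phi> x"
  by (cases x) simp_all

definition satisfies :: "('v \<Rightarrow> bool) \<Rightarrow> 'v clause_set \<Rightarrow> bool" where
  "satisfies \<phi> F \<longleftrightarrow> (\<forall>C\<in>F. \<exists>x\<in>C. lit_true \<phi> x)"

lemma satisfiable_iff_satisfies: "satisfiable F \<longleftrightarrow> (\<exists>\<phi>. satisfies \<phi> F)"
  by (simp add: satisfiable_def satisfies_def)

lemma satisfies_subset: "satisfies \<phi> F \<Longrightarrow> G \<subseteq> F \<Longrightarrow> satisfies \<phi> G"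
  by (auto simp: satisfies_def)

lemma minimally_unsatisfiable_antichain:
  assumes "minimally_unsatisfiable F" "C \<in> F" "D \<in> F" "D \<subseteq> C"
  shows "C = D"
proof (rule ccontr)
  assume "C \<noteq> D"
  obtain \<phi> where \<phi>: "satisfies \<phi> (F - {C})"
    using assms(1,2) by (auto simp: minimally_unsatisfiable_def satisfiable_iff_satisfies)
  then have "\<exists>x\<in>C. lit_true \<phi> x"
    using assms(3,4) \<open>C \<noteq> D\<close> unfolding satisfies_def by blast
  with \<phi> have "satisfies \<phi> F"
    unfolding satisfies_def by blast
  with assms(1) show False
    by (auto simp: minimally_unsatisfiable_def satisfiable_iff_satisfies)
qed

lemma finite_vars: "two_cnf F \<Longrightarrow> finite (vars F)"
  by (auto simp: vars_def two_cnf_def is_clause_def)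


subsection \<open>Unit propagation\<close>

definition make_true :: "'v literal \<Rightarrow> ('v \<Rightarrow> bool) \<Rightarrow> 'v \<Rightarrow> bool" where
  "make_true v \<phi> = \<phi>(var_of v := (v = Pos (var_of v)))"

definition propagate :: "'v literal \<Rightarrow> 'v clause_set \<Rightarrow> 'v clause_set" where
  "propagate v F = (\<lambda>C. C - {complement v}) ` {C \<in> F. v \<notin> C}"

lemma lit_true_make_true:
  "lit_true (make_true v \<phi>) x \<longleftrightarrow> x = v \<or> x \<noteq> complement v \<and> lit_true \<phi> x"
  by (cases v; cases x) (auto simp: make_true_def)

lemma satisfiable_propagate_iff:
  "satisfiable (propagate v F) \<longleftrightarrow> (\<exists>\<phi>. lit_true \<phi> v \<and> satisfies \<phi> F)"
proof
  assume "satisfiable (propagate v F)"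
  then obtain \<phi> where \<phi>: "satisfies \<phi> (propagate v F)"
    by (auto simp: satisfiable_iff_satisfies)
  have "\<exists>x\<in>C. lit_true (make_true v \<phi>) x" if "C \<in> F" for C
    using \<phi> that by (cases "v \<in> C") (auto simp: satisfies_def propagate_def lit_true_make_true)
  then show "\<exists>\<phi>. lit_true \<phi> v \<and> satisfies \<phi> F"
    using lit_true_make_true by (metis satisfies_def)
next
  assume "\<exists>\<phi>. lit_true \<phi> v \<and> satisfies \<phi> F"
  then show "satisfiable (propagate v F)"
    by (fastforce simp: satisfiable_iff_satisfies satisfies_def propagate_def)
qed

lemma satisfiable_propagate_unit_iff:
  assumes "{v} \<in> F"
  shows "satisfiable (propagate v F) \<longleftrightarrow> satisfiable F"
  using assms unfolding satisfiable_propagate_iff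
  by (fastforce simp: satisfiable_iff_satisfies satisfies_def)

lemma two_cnf_propagate:
  assumes "two_cnf F"
  shows "two_cnf (propagate v F)"
proof -
  have "card (C - {complement v}) \<le> 2" if "C \<in> F" for C
    using assms that card_Diff1_le[of C "complement v"] unfolding two_cnf_def by (meson le_trans)
  then show ?thesis
    using assms by (auto simp: two_cnf_def propagate_def is_clause_def)
qed

context
  fixes F :: "'v clause_set" and v
  assumes mu: "minimally_unsatisfiable F" and unit: "{v} \<in> F"
begin

lemma clauses_without_unit: "{C \<in> F. v \<notin> C} = F - {{v}}"
  using minimally_unsatisfiable_antichain[OF mu _ unit] by blast

lemma minimally_unsatisfiable_propagate: "minimally_unsatisfiable (propagate v F)"
  unfolding minimally_unsatisfiable_def
proof (intro conjI ballI)
  show "\<not> satisfiable (propagate v F)"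
    using mu satisfiable_propagate_unit_iff[OF unit] by (simp add: minimally_unsatisfiable_def)
  fix D assume "D \<in> propagate v F"
  then obtain C where C: "C \<in> F" "v \<notin> C" "D = C - {complement v}"
    by (auto simp: propagate_def)
  then have "{v} \<in> F - {C}"
    using unit by auto
  from satisfiable_propagate_unit_iff[OF this] have "satisfiable (propagate v (F - {C}))"
    using mu C(1) by (simp add: minimally_unsatisfiable_def)
  moreover have "propagate v F - {D} \<subseteq> propagate v (F - {C})"
    using C(3) by (auto simp: propagate_def)
  ultimately show "satisfiable (propagate v F - {D})"
    unfolding satisfiable_iff_satisfies using satisfies_subset by blast
qed

lemma card_propagate: "card (propagate v F) = card F - 1"
proof -
  have "inj_on (\<lambda>C. C - {complement v}) (F - {{v}})"
  proof (rule inj_onI)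
    fix C D assume CD: "C \<in> F - {{v}}" "D \<in> F - {{v}}" "C - {complement v} = D - {complement v}"
    then have "C \<subseteq> D \<or> D \<subseteq> C"
      by blast
    then show "C = D"
      using minimally_unsatisfiable_antichain[OF mu] CD(1,2) by blast
  qed
  then show ?thesis
    unfolding propagate_def clauses_without_unit using unit by (simp add: card_image)
qed

lemma vars_propagate: "vars (propagate v F) = vars F - {var_of v}"
proof -
  have "\<Union> (propagate v F) = \<Union> (F - {{v}}) - {complement v}"
    unfolding propagate_def clauses_without_unit by auto
  moreover have "v \<notin> \<Union> (F - {{v}})"
    using clauses_without_unit by blast
  ultimately have "\<Union> (propagate v F) = {x \<in> \<Union> F. var_of x \<noteq> var_of v}"
    by (auto simp: var_of_eq_iff)
  then show ?thesis
    by (auto simp: vars_def)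
qed

lemma deficiency_propagate:
  assumes "two_cnf F"
  shows "deficiency (propagate v F) = deficiency F"
proof -
  have "0 < card F"
    using unit assms by (auto simp: two_cnf_def card_gt_0_iff)
  moreover have "var_of v \<in> vars F"
    using unit unfolding vars_def by force
  then have "card (vars F - {var_of v}) = card (vars F) - 1" "0 < card (vars F)"
    using finite_vars[OF assms] by (auto simp: card_gt_0_iff)
  ultimately show ?thesis
    by (simp add: deficiency_def card_propagate vars_propagate of_nat_diff)
qed

lemma ex_small_clause_propagate:
  assumes "two_cnf F"
  obtains D where "D \<in> propagate v F" "card D \<le> 1"
proof -
  obtain D where D: "D \<in> F" "complement v \<in> D"
  proof (rule ccontr)
    assume "\<not> thesis"
    with that have "propagate v F = F - {{v}}"
      unfolding propagate_def clauses_without_unit by force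
    then show False
      using minimally_unsatisfiable_propagate mu unit by (auto simp: minimally_unsatisfiable_def)
  qed
  have "finite D" "card D \<le> 2" "v \<notin> D"
    using assms D by (auto simp: two_cnf_def is_clause_def)
  then have "D - {complement v} \<in> propagate v F" "card (D - {complement v}) \<le> 1"
    using D by (auto simp: propagate_def)
  then show thesis
    by (rule that)
qed

end

text \<open>Unit propagation shortens a clause containing the complement of the unit, so that it can be repeated
  until the empty clause appears.\<close>

lemma deficiency_eq_1_if_small_clause:
  assumes "two_cnf F" "minimally_unsatisfiable F" "C \<in> F" "card C \<le> 1"
  shows "deficiency F = 1"
  using assms
proof (induction "card (vars F)" arbitrary: F C rule: less_induct)
  case less
  note cnf = less.prems(1) and mu = less.prems(2)
  have "finite C"
    using cnf less.prems(3) by (auto simp: two_cnf_def is_clause_def)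
  then consider "{} \<in> F" | v where "{v} \<in> F"
    using less.prems(3,4) by (metis card_0_eq card_1_singletonE le_eq_less_or_eq less_one)
  then show ?case
  proof cases
    case 1
    then have "F = {{}}"
      using minimally_unsatisfiable_antichain[OF mu] by blast
    then show ?thesis
      by (simp add: deficiency_def vars_def)
  next
    case (2 v)
    then have "var_of v \<in> vars F"
      unfolding vars_def by force
    then have "card (vars (propagate v F)) < card (vars F)"
      unfolding vars_propagate[OF mu 2] using finite_vars[OF cnf] by (intro card_Diff1_less)
    moreover obtain D where "D \<in> propagate v F" "card D \<le> 1"
      by (rule ex_small_clause_propagate[OF mu 2 cnf])
    ultimately have "deficiency (propagate v F) = 1"
      using less.hyps two_cnf_propagate[OF cnf] minimally_unsatisfiable_propagate[OF mu 2] by blast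
    then show ?thesis
      using deficiency_propagate[OF mu 2 cnf] by simp
  qed
qed

lemma card_clause_eq_2:
  assumes "two_cnf F" "minimally_unsatisfiable F" "2 \<le> deficiency F" "C \<in> F"
  shows "card C = 2"
proof -
  have "\<not> card C \<le> 1"
    using deficiency_eq_1_if_small_clause[OF assms(1,2,4)] assms(3) by auto
  moreover have "card C \<le> 2"
    using assms(1,4) by (simp add: two_cnf_def)
  ultimately show ?thesis by simp
qed


section \<open>Implication digraphs\<close>

lemma in_litsI: "x \<in> C \<Longrightarrow> C \<in> F \<Longrightarrow> x \<in> lits F"
  by (auto simp: lits_def vars_def)

lemma complement_in_lits_iff [simp]: "complement x \<in> lits F \<longleftrightarrow> x \<in> lits F"
  by (simp add: lits_def)

lemma finite_lits:
  assumes "two_cnf F"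
  shows "finite (lits F)"
proof -
  have "lits F \<subseteq> Pos ` vars F \<union> Neg ` vars F"
  proof
    fix x assume "x \<in> lits F"
    then show "x \<in> Pos ` vars F \<union> Neg ` vars F"
      by (cases x) (auto simp: lits_def)
  qed
  then show ?thesis
    using finite_vars[OF assms] by (auto intro: finite_subset)
qed

lemma pverts_idg [simp]: "pverts (idg F) = lits F"
  by (simp add: idg_def)

lemma idg_arc_iff: "(u, w) \<in> parcs (idg F) \<longleftrightarrow> {complement u, w} \<in> F"
proof
  assume "(u, w) \<in> parcs (idg F)"
  then show "{complement u, w} \<in> F"
    by (auto simp: idg_def)
next
  assume "{complement u, w} \<in> F"
  moreover have "u = complement (complement u)"
    by simp
  ultimately show "(u, w) \<in> parcs (idg F)"
    unfolding idg_def by (cases "w = complement u") force+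
qed

lemma skew_digraph_idg: "skew_digraph (lits F) (parcs (idg F)) complement"
proof
  show "parcs (idg F) \<subseteq> lits F \<times> lits F"
  proof
    fix e assume "e \<in> parcs (idg F)"
    then obtain u w where e: "e = (u, w)" and uw: "{complement u, w} \<in> F"
      by (cases e) (auto simp: idg_arc_iff)
    have "complement u \<in> lits F" "w \<in> lits F"
      by (rule in_litsI[OF _ uw], simp)+
    with e show "e \<in> lits F \<times> lits F"
      by simp
  qed
qed (simp_all add: idg_arc_iff insert_commute)

lemma two_cnf_clauseE:
  assumes "two_cnf F" "{} \<notin> F" "C \<in> F"
  obtains x y where "C = {x, y}"
proof -
  have "finite C" "card C \<le> 2" "C \<noteq> {}"
    using assms by (auto simp: two_cnf_def is_clause_def)
  then have "card C = 1 \<or> card C = 2"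
    by (metis One_nat_def Suc_1 card_gt_0_iff le_SucE le_zero_eq less_numeral_extra(3))
  then show thesis
    using that by (metis card_1_singletonE card_2_iff insert_absorb2)
qed

lemma satisfiable_imp_not_contradictory:
  assumes "satisfiable F"
  shows "\<not> contradictory V complement (parcs (idg F))"
proof -
  obtain \<phi> where \<phi>: "satisfies \<phi> F"
    using assms by (auto simp: satisfiable_iff_satisfies)
  have "lit_true \<phi> w" if "(u, w) \<in> (parcs (idg F))\<^sup>*" "lit_true \<phi> u" for u w
    using that
  proof (induction rule: rtrancl_induct)
    case (step y z)
    then have "{complement y, z} \<in> F"
      by (simp add: idg_arc_iff)
    then show ?case
      using \<phi> step by (fastforce simp: satisfies_def)
  qed
  then show ?thesis
    unfolding contradictory_def by (metis lit_true_complement)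
qed

lemma satisfiable_if_not_contradictory:
  assumes cnf: "two_cnf F" "{} \<notin> F"
    and no_contradiction: "\<not> contradictory (lits F) complement (parcs (idg F))"
  shows "satisfiable F"
proof -
  interpret skew_digraph "lits F" "parcs (idg F)" complement
    by (rule skew_digraph_idg)
  obtain T where T: "consistent_closed T" and total: "\<And>x. x \<in> lits F \<Longrightarrow> x \<in> T \<or> complement x \<in> T"
    by (rule ex_total_consistent_closed[OF finite_lits[OF cnf(1)] no_contradiction]) blast
  define \<phi> where "\<phi> = (\<lambda>v. Pos v \<in> T)"
  have true: "lit_true \<phi> x" if "x \<in> T" for x
    using that T by (cases x) (auto simp: \<phi>_def consistent_closed_def)
  have "\<exists>x\<in>C. lit_true \<phi> x" if C: "C \<in> F" for C
  proof -
    obtain x y where xy: "C = {x, y}"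
      using two_cnf_clauseE[OF cnf C] .
    then have "(complement x, y) \<in> parcs (idg F)" "x \<in> lits F"
      using C by (auto simp: idg_arc_iff intro: in_litsI)
    then have "x \<in> T \<or> y \<in> T"
      using total[of x] T by (auto simp: consistent_closed_def)
    then show ?thesis
      using true xy by auto
  qed
  then show ?thesis
    by (auto simp: satisfiable_iff_satisfies satisfies_def)
qed

lemma parcs_idg_remove_clause:
  "parcs (idg (F - {{complement u, w}})) = parcs (idg F) - {(u, w), (complement w, complement u)}"
proof -
  have "{complement x, y} = {complement u, w} \<longleftrightarrow> (x, y) \<in> {(u, w), (complement w, complement u)}" for x y
    by (metis complement_complement doubleton_eq_iff insert_iff prod.inject singletonD)
  then show ?thesis
    by (auto simp: idg_arc_iff)
qed

lemma lits_subset_Field_idg: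
  assumes "two_cnf F" "{} \<notin> F"
  shows "lits F \<subseteq> Field (parcs (idg F))"
proof
  fix v assume "v \<in> lits F"
  then obtain C x where x: "C \<in> F" "x \<in> C" "var_of v = var_of x"
    by (auto simp: lits_def vars_def)
  obtain a b where "C = {a, b}"
    using two_cnf_clauseE[OF assms x(1)] .
  with x(1,2) obtain y where "{x, y} \<in> F"
    by (auto simp: insert_commute)
  then have "(complement x, y) \<in> parcs (idg F)" "(complement y, x) \<in> parcs (idg F)"
    by (simp_all add: idg_arc_iff insert_commute)
  moreover have "v = x \<or> v = complement x"
    using x(3) by (simp add: var_of_eq_iff)
  ultimately show "v \<in> Field (parcs (idg F))"
    by (auto simp: Field_def)
qed

lemma min_contradictory_digraph_idg:
  assumes cnf: "two_cnf F" and mu: "minimally_unsatisfiable F" and deficiency: "2 \<le> deficiency F"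
  shows "min_contradictory_digraph (lits F) (parcs (idg F)) complement"
proof -
  note card = card_clause_eq_2[OF cnf mu deficiency]
  have no_empty: "{} \<notin> F"
    using card by fastforce
  interpret skew_digraph "lits F" "parcs (idg F)" complement
    by (rule skew_digraph_idg)
  show ?thesis
  proof
    show "(v, complement v) \<notin> parcs (idg F)" for v
      using card[of "{complement v}"] by (auto simp: idg_arc_iff)
    show "contradictory (lits F) complement (parcs (idg F))"
      using satisfiable_if_not_contradictory[OF cnf no_empty] mu
      by (auto simp: minimally_unsatisfiable_def)
    show "\<not> contradictory (lits F) complement
        (parcs (idg F) - {(u, w), (complement w, complement u)})"
      if "(u, w) \<in> parcs (idg F)" for u w
    proof -
      have "satisfiable (F - {{complement u, w}})"
        using that mu by (simp add: idg_arc_iff minimally_unsatisfiable_def)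
      then show ?thesis
        unfolding parcs_idg_remove_clause[symmetric] by (rule satisfiable_imp_not_contradictory)
    qed
  qed (use finite_lits[OF cnf] lits_subset_Field_idg[OF cnf no_empty] in simp_all)
qed


section \<open>Isomorphisms of 2-CNFs\<close>

lemma clauses_of_idg:
  assumes "two_cnf F" "{} \<notin> F"
  shows "(\<lambda>(u, w). {complement u, w}) ` parcs (idg F) = F"
proof
  show "(\<lambda>(u, w). {complement u, w}) ` parcs (idg F) \<subseteq> F"
    by (auto simp: idg_arc_iff)
  show "F \<subseteq> (\<lambda>(u, w). {complement u, w}) ` parcs (idg F)"
  proof
    fix C assume "C \<in> F"
    then obtain x y where xy: "C = {x, y}"
      by (rule two_cnf_clauseE[OF assms])
    with \<open>C \<in> F\<close> have "(complement x, y) \<in> parcs (idg F)"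
      by (simp add: idg_arc_iff)
    then show "C \<in> (\<lambda>(u, w). {complement u, w}) ` parcs (idg F)"
      by (rule rev_image_eqI) (simp add: xy)
  qed
qed

lemma parcs_idg_image:
  assumes cnf: "two_cnf F" "{} \<notin> F"
    and commutes: "\<And>x. x \<in> lits F \<Longrightarrow> f (complement x) = complement (f x)"
  shows "parcs (idg ((`) f ` F)) = map_prod f f ` parcs (idg F)"
proof
  show "map_prod f f ` parcs (idg F) \<subseteq> parcs (idg ((`) f ` F))"
  proof
    fix e assume "e \<in> map_prod f f ` parcs (idg F)"
    then obtain u w where e: "e = (f u, f w)" and uw: "{complement u, w} \<in> F"
      by (auto simp: idg_arc_iff)
    have "u \<in> lits F"
      using in_litsI[OF _ uw, of "complement u"] by simp
    then have "f ` {complement u, w} = {complement (f u), f w}"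
      by (simp add: commutes)
    with uw have "{complement (f u), f w} \<in> (`) f ` F"
      by (metis imageI)
    then show "e \<in> parcs (idg ((`) f ` F))"
      by (simp add: e idg_arc_iff)
  qed
  show "parcs (idg ((`) f ` F)) \<subseteq> map_prod f f ` parcs (idg F)"
  proof
    fix e assume "e \<in> parcs (idg ((`) f ` F))"
    then obtain u w C where e: "e = (u, w)" and C: "C \<in> F" "f ` C = {complement u, w}"
      by (cases e) (auto simp: idg_arc_iff)
    obtain a b where ab: "C = {a, b}"
      using two_cnf_clauseE[OF cnf C(1)] .
    then have "f a = complement u \<and> f b = w \<or> f a = w \<and> f b = complement u"
      using C(2) by (simp add: doubleton_eq_iff)
    then obtain x y where xy: "{x, y} \<in> F" "f x = complement u" "f y = w"
      using C(1) ab by (metis insert_commute)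
    have "f (complement x) = u"
      using commutes[OF in_litsI[OF _ xy(1)], of x] xy(2) by simp
    moreover have "(complement x, y) \<in> parcs (idg F)"
      using xy(1) by (simp add: idg_arc_iff)
    ultimately show "e \<in> map_prod f f ` parcs (idg F)"
      unfolding e xy(3)[symmetric] by blast
  qed
qed

lemma clause_image_eq_iff_arc_image_eq:
  assumes "two_cnf F" "{} \<notin> F" "two_cnf F'" "{} \<notin> F'"
    and commutes: "\<And>x. x \<in> lits F \<Longrightarrow> f (complement x) = complement (f x)"
  shows "(`) f ` F = F' \<longleftrightarrow> map_prod f f ` parcs (idg F) = parcs (idg F')"
proof
  assume "(`) f ` F = F'"
  then show "map_prod f f ` parcs (idg F) = parcs (idg F')"
    using parcs_idg_image[where f = f, OF assms(1,2) commutes] by simp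
next
  let ?clause = "\<lambda>(u, w). {complement u, w}"
  assume arcs: "map_prod f f ` parcs (idg F) = parcs (idg F')"
  have "f ` ?clause e = ?clause (map_prod f f e)" if "e \<in> parcs (idg F)" for e
  proof (cases e)
    case (Pair u w)
    then have "u \<in> lits F"
      using that skew_digraph.arc_in_V(1)[OF skew_digraph_idg] by blast
    then show ?thesis
      by (simp add: Pair commutes)
  qed
  then have "(`) f ` ?clause ` parcs (idg F) = ?clause ` map_prod f f ` parcs (idg F)"
    unfolding image_image by (rule image_cong[OF refl])
  then show "(`) f ` F = F'"
    unfolding arcs clauses_of_idg[OF assms(1,2)] clauses_of_idg[OF assms(3,4)] .
qed

lemma cnf_isos_iff:
  "f \<in> cnf_isos F F' \<longleftrightarrow> f \<in> extensional (lits F) \<and> bij_betw f (lits F) (lits F') \<and>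
     (\<forall>x\<in>lits F. f (complement x) = complement (f x)) \<and> (`) f ` F = F'"
  by (simp add: cnf_isos_def Setcompr_eq_image)

lemma digraph_isos_iff:
  "f \<in> digraph_isos G H \<longleftrightarrow> f \<in> extensional (pverts G) \<and> bij_betw f (pverts G) (pverts H) \<and>
     map_prod f f ` parcs G = parcs H"
proof -
  have "{(f u, f v) | u v. (u, v) \<in> parcs G} = map_prod f f ` parcs G"
    by force
  then show ?thesis
    by (simp add: digraph_isos_def)
qed

lemma cnf_isos_eq_commuting_digraph_isos:
  assumes "two_cnf F" "{} \<notin> F" "two_cnf F'" "{} \<notin> F'"
  shows "cnf_isos F F' = {f \<in> digraph_isos (idg F) (idg F').
    \<forall>x\<in>lits F. f (complement x) = complement (f x)}"
proof (rule set_eqI)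
  fix f
  have "(`) f ` F = F' \<longleftrightarrow> map_prod f f ` parcs (idg F) = parcs (idg F')"
    if "\<forall>x\<in>lits F. f (complement x) = complement (f x)"
    using assms by (rule clause_image_eq_iff_arc_image_eq) (use that in blast)
  then show "f \<in> cnf_isos F F' \<longleftrightarrow> f \<in> {f \<in> digraph_isos (idg F) (idg F').
      \<forall>x\<in>lits F. f (complement x) = complement (f x)}"
    unfolding cnf_isos_iff digraph_isos_iff mem_Collect_eq pverts_idg by argo
qed

theorem theorem7p8:
  fixes F :: "'v clause_set" and F' :: "'w clause_set" and k :: int
  assumes "k \<ge> 2"
    and "two_cnf F" and "minimally_unsatisfiable F" and "deficiency F = k"
    and "two_cnf F'" and "minimally_unsatisfiable F'" and "deficiency F' = k"
  shows "cnf_isos F F' = digraph_isos (idg F) (idg F')"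
proof -
  have no_empty: "{} \<notin> F" "{} \<notin> F'"
    using card_clause_eq_2[of F "{}"] card_clause_eq_2[of F' "{}"] assms by auto
  have "min_contradictory_digraph (lits F) (parcs (idg F)) complement"
    and "min_contradictory_digraph (lits F') (parcs (idg F')) complement"
    using assms by (simp_all add: min_contradictory_digraph_idg)
  from min_contradictory_digraph_iso_commutes[OF this]
  have "f (complement x) = complement (f x)"
    if "f \<in> digraph_isos (idg F) (idg F')" "x \<in> lits F" for f x
    using that by (simp add: digraph_isos_iff)
  then show ?thesis
    unfolding cnf_isos_eq_commuting_digraph_isos[OF assms(2) no_empty(1) assms(5) no_empty(2)]
    by blast
qed

end
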